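(* Let $A\subset\mathbb{P}$ be a set of primes whose natural density in $\mathbb{P}$ is $D_{\text{nat-prime}}(A)=\theta\in(0,1]$. Then for every integer $k\ge2$, $$\lim_{N\to\infty}\frac{\sum_{n:\ p\mid n\Rightarrow p\le N\text{ and }p\in A}\frac1n}{\sum^{'(k)}_{n\le N:\ p\mid n\Rightarrow p\in A}\frac1{n_{\{(k-1)\text{-free}\}}\,\phi\big(n_{\{(k-1)\text{-power}\}}\big)}}=e^{\gamma\theta}\,\Gamma(\theta+1),$$ where $\phi$ is Euler's totient function.
   Context: $\mathbb{P}$ denotes the set of primes; $D_{\text{nat-prime}}(A)=\lim_{N\to\infty}\frac{|A\cap\{1,\dots,N\}|}{|\mathbb{P}\cap\{1,\dots,N\}|}$, assumed to exist. Sums are over positive integers $n$ (including $n=1$) satisfying the stated conditions on their prime divisors $p$. For $k\ge2$, $n$ is $k$-free if $p^k\nmid n$ for every prime $p$, and $\sum^{'(k)}$ denotes the sum restricted to $k$-free integers. For $m\ge2$, every $n\in\mathbb{N}$ can be written uniquely as $n=n_{\{m\text{-free}\}}\,n_{\{m\text{-power}\}}$ where $n_{\{m\text{-free}\}}$ is $m$-free and $n_{\{m\text{-power}\}}$ is an $m$-th power of a positive integer; for $m=1$ one sets $n_{\{1\text{-free}\}}=1$ and $n_{\{1\text{-power}\}}=n$. $\gamma$ is the Euler–Mascheroni constant and $\Gamma$ the Gamma function. *)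

theory Defs
  imports
    "HOL-Analysis.Analysis"
    "HOL-Number_Theory.Number_Theory"
    "HOL-Computational_Algebra.Computational_Algebra"
begin

definition has_prime_density :: "nat set \<Rightarrow> real \<Rightarrow> bool" where
  "has_prime_density A \<theta> \<longleftrightarrow>
     (\<lambda>N. real (card (A \<inter> {1..N})) / real (card ({p. prime p} \<inter> {1..N}))) \<longlonglongrightarrow> \<theta>"

definition kfree :: "nat \<Rightarrow> nat \<Rightarrow> bool" where
  "kfree k n \<longleftrightarrow> (\<forall>p. prime p \<longrightarrow> \<not> p ^ k dvd n)"

text \<open>
  For \<open>m \<ge> 2\<close> and \<open>n \<ge> 1\<close> the two components of the unique factorization of \<open>n\<close> into an
  \<open>m\<close>-free number and a positive \<open>m\<close>-th power; uniqueness is lemma \<open>free_power_decomp\<close> below.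
  The values for \<open>m = 0\<close> or \<open>n = 0\<close> are irrelevant.
\<close>

definition free_part :: "nat \<Rightarrow> nat \<Rightarrow> nat" where
  "free_part m n =
     (if m = 1 then 1
      else THE a. kfree m a \<and> (\<exists>b. b > 0 \<and> is_nth_power m b \<and> n = a * b))"

definition power_part :: "nat \<Rightarrow> nat \<Rightarrow> nat" where
  "power_part m n =
     (if m = 1 then n
      else THE b. b > 0 \<and> is_nth_power m b \<and> (\<exists>a. kfree m a \<and> n = a * b))"

lemma free_power_decomp_exists:
  assumes "m \<ge> 1" "n > 0"
  shows "\<exists>a b. kfree m a \<and> b > 0 \<and> is_nth_power m b \<and> n = a * b"
proof -
  define a where "a = (\<Prod>p\<in>prime_factors n. p ^ (multiplicity p n mod m))"
  define c where "c = (\<Prod>p\<in>prime_factors n. p ^ (multiplicity p n div m))"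
  have pos: "a > 0" "c > 0"
    unfolding a_def c_def by (auto intro!: prod_pos zero_less_power prime_gt_0_nat dest: in_prime_factors_imp_prime)
  have "n = (\<Prod>p\<in>prime_factors n. p ^ multiplicity p n)"
    using assms by (intro prime_factorization_nat)
  also have "\<dots> = (\<Prod>p\<in>prime_factors n.
      p ^ (multiplicity p n mod m) * (p ^ (multiplicity p n div m)) ^ m)"
    by (intro prod.cong refl) (simp flip: power_mult power_add)
  also have "\<dots> = a * c ^ m"
    by (simp add: a_def c_def prod.distrib prod_power_distrib)
  finally have "n = a * c ^ m" .
  moreover have "kfree m a"
    unfolding kfree_def
  proof (intro allI impI)
    fix p :: nat assume p: "prime p"
    have "multiplicity p a < m"
      unfolding a_def using assms p by (subst multiplicity_prod_prime_powers) auto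
    then show "\<not> p ^ m dvd a"
      using p pos by (subst power_dvd_iff_le_multiplicity) auto
  qed
  ultimately show ?thesis
    using pos by (intro exI[of _ a] exI[of _ "c ^ m"]) auto
qed

lemma free_power_decomp_unique:
  assumes "kfree m a" "b > 0" "is_nth_power m b" "n = a * b"
    and "kfree m a'" "b' > 0" "is_nth_power m b'" "n = a' * b'"
    and "n > 0"
  shows "a = a'" "b = b'"
proof -
  from assms obtain c c' where c: "b = c ^ m" "b' = c' ^ m"
    by (auto elim!: is_nth_powerE)
  have pos: "a > 0" "a' > 0" using assms(4,8,9) by (metis mult_0 neq0_conv)+
  show "b = b'"
  proof (rule multiplicity_eq_nat)
    fix p :: nat assume p: "prime p"
    have lt: "multiplicity p a < m" "multiplicity p a' < m"
      using assms(1,5) p pos unfolding kfree_def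
      by (metis multiplicity_dvd' not_le)+
    have e: "multiplicity p a + multiplicity p b = multiplicity p a' + multiplicity p b'"
      using assms p pos by (metis prime_elem_multiplicity_mult_distrib
          prime_imp_prime_elem less_numeral_extra(3))
    have mb: "multiplicity p b = m * multiplicity p c" "multiplicity p b' = m * multiplicity p c'"
      using c assms p lt by (auto simp: prime_elem_multiplicity_power_distrib)
    have "multiplicity p c = multiplicity p c'"
    proof -
      have "(multiplicity p a + m * multiplicity p c) div m =
            (multiplicity p a' + m * multiplicity p c') div m"
        using e mb by simp
      then show ?thesis using lt by (simp add: div_mult_self2)
    qed
    then show "multiplicity p b = multiplicity p b'" using mb by simp
  qed (use assms in auto)
  then show "a = a'" using assms by simp
qed

lemma free_power_decomp:
  assumes "m \<ge> 1" "n > 0"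
  shows "\<exists>!ab. kfree m (fst ab) \<and> snd ab > 0 \<and> is_nth_power m (snd ab) \<and> n = fst ab * snd ab"
proof -
  obtain a b where ab: "kfree m a" "b > 0" "is_nth_power m b" "n = a * b"
    using free_power_decomp_exists[OF assms] by blast
  show ?thesis
  proof (rule ex1I[of _ "(a, b)"])
    fix ab' assume "kfree m (fst ab') \<and> snd ab' > 0 \<and> is_nth_power m (snd ab') \<and>
      n = fst ab' * snd ab'"
    then have "a = fst ab'" "b = snd ab'"
      using free_power_decomp_unique[OF ab _ _ _ _ assms(2)] by blast+
    then show "ab' = (a, b)" by simp
  qed (use ab in simp)
qed

end

(*
  Both sides are compared with the Dirichlet series F(s) = sum w(n) n^(-s) over the A-smooth
  k-free integers n, at s = 1 / ln N.  The weight w is multiplicative and its Euler factor at s = 0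
  is exactly 1 / (1 - 1/p), so ln F(s) and the logarithm of the numerator differ from
  sum_{p in A} p^(-1-s) and sum_{p in A, p <= N} 1/p by quantities with the same limit.

  Abel summation turns the density hypothesis into s * sum_{p in A} ln p * p^(-1-s) --> theta as
  s -> 0+; for the set of all primes this follows from sum n^(-1-s) ~ 1/s, so neither the prime
  number theorem nor Chebyshev's bounds are needed.  Karamata's method (polynomial approximation of test
  functions of e^(-s l)) then yields F(js) / F(s) --> j^(-theta), the Tauberian asymptotics of the
  partial sums of w, and the cutoff comparison of the two sums over p.

  No integral is evaluated: a limit given by Karamata's method depends only on the index of regular
  variation, so it can be read off from the explicit family b(n) = pochhammer theta n / n! with
  exponents l(n) = n, whose Laplace transform is (1 - e^(-s))^(-theta).  Its partial sums give
  Gamma (theta + 1) by Euler's limit formula, and theta = 1 gives harmonic numbers, hence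
  Euler's constant.
*)
theory Submission
  imports Defs "HOL-Real_Asymp.Real_Asymp"
begin

section \<open>Karamata's method\<close>

text \<open>The density hypothesis fixes F only up to an unknown slowly varying factor: the sum of
  1/p over p in A, p <= N, need not be \<theta> ln ln N plus a constant plus o(1). So neither side
  has an explicit asymptotic formula to prove, and every limit below concerns a normalised quantity:
  a mean divided by total mass, a quotient F(js) / F(s), or a difference of two prime sums. The
  unknown factor disappears only when both sides are divided by the same F(1 / ln N). The two
  constants arise from the same operation applied at different places. Replacing the soft cutoff
  p^(-s) by the sharp one p <= N in the prime sum costs \<gamma>\<theta> in the logarithm; replacing
  n^(-s) by n <= N in the sum over integers costs Gamma (\<theta> + 1). Both cutoffs are
  discontinuous, whereas polynomial approximation handles continuous test functions only, so jumps
  are isolated in a step function and squeezed between ramps.\<close>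

text \<open>The exponents are left general: \<open>l n = n\<close> gives power series in e^(-s),
  \<open>l n = ln n\<close> Dirichlet series. The extra factor e^(-s l) makes the constant test
  function return the Laplace transform itself.\<close>

definition laplace_sum :: "(nat \<Rightarrow> real) \<Rightarrow> (nat \<Rightarrow> real) \<Rightarrow> (real \<Rightarrow> real) \<Rightarrow> real \<Rightarrow> real" where
  "laplace_sum a l g s = (\<Sum>n. a n * exp (- (s * l n)) * g (exp (- (s * l n))))"

definition laplace_mean :: "(nat \<Rightarrow> real) \<Rightarrow> (nat \<Rightarrow> real) \<Rightarrow> (real \<Rightarrow> real) \<Rightarrow> real \<Rightarrow> real" where
  "laplace_mean a l g s = laplace_sum a l g s / laplace_sum a l (\<lambda>_. 1) s"

definition bounded_test :: "(real \<Rightarrow> real) \<Rightarrow> bool" where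
  "bounded_test g \<longleftrightarrow> (\<exists>B. \<forall>x\<in>{0<..1}. \<bar>g x\<bar> \<le> B)"

lemma bounded_testI: "(\<And>x. 0 < x \<Longrightarrow> x \<le> 1 \<Longrightarrow> \<bar>g x\<bar> \<le> B) \<Longrightarrow> bounded_test g"
  unfolding bounded_test_def by (intro exI[of _ B]) simp

lemma bounded_test_continuous:
  assumes "continuous_on {0..1} g"
  shows "bounded_test g"
proof -
  have "bounded (g ` {0..1})"
    using assms compact_continuous_image compact_imp_bounded by blast
  then obtain B where "\<And>x. x \<in> {0..1} \<Longrightarrow> \<bar>g x\<bar> \<le> B"
    unfolding bounded_iff by force
  then show ?thesis by (intro bounded_testI[of _ B]) auto
qed

lemma bounded_test_add [intro]:
  assumes "bounded_test g" "bounded_test h"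
  shows "bounded_test (\<lambda>x. g x + h x)"
proof -
  obtain B C where "\<And>x. x \<in> {0<..1} \<Longrightarrow> \<bar>g x\<bar> \<le> B" "\<And>x. x \<in> {0<..1} \<Longrightarrow> \<bar>h x\<bar> \<le> C"
    using assms unfolding bounded_test_def by blast
  then show ?thesis
    by (intro bounded_testI[of _ "B + C"] order_trans[OF abs_triangle_ineq] add_mono) auto
qed

lemma bounded_test_cmult [intro]:
  assumes "bounded_test g"
  shows "bounded_test (\<lambda>x. c * g x)"
proof -
  obtain B where "\<And>x. x \<in> {0<..1} \<Longrightarrow> \<bar>g x\<bar> \<le> B"
    using assms unfolding bounded_test_def by blast
  then show ?thesis
    by (intro bounded_testI[of _ "\<bar>c\<bar> * B"]) (auto simp: abs_mult intro!: mult_left_mono)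
qed

lemma bounded_test_const [simp]: "bounded_test (\<lambda>_. c)"
  by (intro bounded_testI[of _ "\<bar>c\<bar>"]) auto

lemma bounded_test_power [simp]: "bounded_test (\<lambda>x. x ^ i)"
  by (intro bounded_test_continuous continuous_intros)

text \<open>
  The factor \<open>1 / x\<close> cancels the exponential in \<open>laplace_sum\<close>, so this test function
  produces the plain partial sum of the weights with \<open>s * l n \<le> y\<close>.
\<close>
definition step_test :: "real \<Rightarrow> real \<Rightarrow> real" where
  "step_test y x = (if exp (- y) \<le> x then 1 / x else 0)"

lemma bounded_test_step: "bounded_test (step_test y)"
proof (intro bounded_testI)
  fix x :: real assume "0 < x" "x \<le> 1"
  then show "\<bar>step_test y x\<bar> \<le> exp y"
    by (auto simp: step_test_def exp_minus field_simps)
qed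

text \<open>A continuous stand-in for a step test: the numerator rises linearly from 0 at u to 1 at
  v, and \<open>max x u\<close> replaces the denominator x so that nothing blows up near 0 while the
  numerator vanishes there.\<close>

definition ramp :: "real \<Rightarrow> real \<Rightarrow> real \<Rightarrow> real" where
  "ramp u v x = max 0 (min 1 ((x - u) / (v - u))) / max x u"

lemma continuous_on_ramp: "0 < u \<Longrightarrow> u < v \<Longrightarrow> continuous_on S (ramp u v)"
  unfolding ramp_def by (intro continuous_intros) auto

lemma step_le_ramp:
  assumes "y < z" "0 < x"
  shows "step_test y x \<le> ramp (exp (- z)) (exp (- y)) x"
    and "ramp (exp (- z)) (exp (- y)) x \<le> step_test z x"
proof -
  have lt: "exp (- z) < exp (- y)" using assms by simp
  show "step_test y x \<le> ramp (exp (- z)) (exp (- y)) x"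
    using assms lt by (auto simp: step_test_def ramp_def field_simps max_def min_def dest: order_trans)
  show "ramp (exp (- z)) (exp (- y)) x \<le> step_test z x"
  proof (cases "exp (- z) \<le> x")
    case True
    then show ?thesis
      using assms by (auto simp: step_test_def ramp_def max_def min_def divide_right_mono)
  next
    case False
    then have "(x - exp (- z)) / (exp (- y) - exp (- z)) \<le> 0"
      using lt by (intro divide_nonpos_pos) auto
    then show ?thesis
      using assms by (simp add: step_test_def ramp_def)
  qed
qed

text \<open>\<rho> is the index of regular variation at 0. Only integer dilations j are demanded,
  because these are exactly what polynomials in e^(-s l) can see.\<close>

locale laplace_family =
  fixes a l :: "nat \<Rightarrow> real" and \<rho> :: real
  assumes weight_nonneg: "a n \<ge> 0" and exponent_nonneg: "l n \<ge> 0"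
    and summable_weights: "s > 0 \<Longrightarrow> summable (\<lambda>n. a n * exp (- (s * l n)))"
    and laplace_pos: "s > 0 \<Longrightarrow> laplace_sum a l (\<lambda>_. 1) s > 0"
    and regular: "j \<ge> 1 \<Longrightarrow> ((\<lambda>s. laplace_sum a l (\<lambda>_. 1) (real j * s) / laplace_sum a l (\<lambda>_. 1) s)
                     \<longlongrightarrow> real j powr (- \<rho>)) (at_right 0)"
begin

lemma exponential_range: "s > 0 \<Longrightarrow> exp (- (s * l n)) \<in> {0<..1}"
  using exponent_nonneg[of n] by simp

lemma summable_test:
  assumes "s > 0" "bounded_test g"
  shows "summable (\<lambda>n. a n * exp (- (s * l n)) * g (exp (- (s * l n))))"
proof -
  obtain B where B: "\<And>x. x \<in> {0<..1} \<Longrightarrow> \<bar>g x\<bar> \<le> B"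
    using assms(2) unfolding bounded_test_def by blast
  show ?thesis
  proof (rule summable_comparison_test')
    show "summable (\<lambda>n. B * (a n * exp (- (s * l n))))"
      using summable_weights[OF assms(1)] by (rule summable_mult)
    fix n show "norm (a n * exp (- (s * l n)) * g (exp (- (s * l n)))) \<le> B * (a n * exp (- (s * l n)))"
      using B[OF exponential_range[OF assms(1), of n]] weight_nonneg[of n]
      by (auto simp: abs_mult mult.commute[of B] intro!: mult_left_mono)
  qed
qed

lemma mean_mono:
  assumes "s > 0" "bounded_test g" "bounded_test h" "\<And>x. 0 < x \<Longrightarrow> x \<le> 1 \<Longrightarrow> g x \<le> h x"
  shows "laplace_mean a l g s \<le> laplace_mean a l h s"
  unfolding laplace_mean_def laplace_sum_def
proof (intro divide_right_mono suminf_le summable_test assms)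
  show "a n * exp (- (s * l n)) * g (exp (- (s * l n))) \<le> a n * exp (- (s * l n)) * h (exp (- (s * l n)))" for n
    using assms(4)[of "exp (- (s * l n))"] exponential_range[OF assms(1), of n] weight_nonneg[of n]
    by (intro mult_left_mono) auto
  show "0 \<le> (\<Sum>n. a n * exp (- (s * l n)) * 1)"
    using laplace_pos[OF assms(1)] by (simp add: laplace_sum_def)
qed

lemma mean_add:
  assumes "s > 0" "bounded_test g" "bounded_test h"
  shows "laplace_mean a l (\<lambda>x. g x + h x) s = laplace_mean a l g s + laplace_mean a l h s"
  unfolding laplace_mean_def laplace_sum_def
  using suminf_add[OF summable_test[OF assms(1,2)] summable_test[OF assms(1,3)]]
  by (simp add: add_divide_distrib[symmetric] distrib_left)

lemma mean_cmult:
  assumes "s > 0" "bounded_test g"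
  shows "laplace_mean a l (\<lambda>x. c * g x) s = c * laplace_mean a l g s"
  unfolding laplace_mean_def laplace_sum_def
  using suminf_mult[OF summable_test[OF assms], of c] by (simp add: mult_ac)

lemma mean_const: "s > 0 \<Longrightarrow> laplace_mean a l (\<lambda>_. c) s = c"
  using mean_cmult[of s "\<lambda>_. 1" c] laplace_pos[of s] by (simp add: laplace_mean_def)

text \<open>Against the weight e^(-s l), the monomial x^i turns s into (i + 1) s, so the i-th moment
  is the regularity assumption at j = i + 1.\<close>

lemma mean_power_tendsto:
  "((\<lambda>s. laplace_mean a l (\<lambda>x. x ^ i) s) \<longlongrightarrow> real (Suc i) powr (- \<rho>)) (at_right 0)"
proof -
  have "laplace_sum a l (\<lambda>x. x ^ i) s = laplace_sum a l (\<lambda>_. 1) (real (Suc i) * s)" for s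
    unfolding laplace_sum_def
    by (intro suminf_cong) (simp add: exp_of_nat_mult[symmetric] exp_add[symmetric] algebra_simps)
  then show ?thesis
    using regular[of "Suc i"] unfolding laplace_mean_def by simp
qed

lemma bounded_test_poly: "bounded_test (\<lambda>x. \<Sum>i\<le>n. c i * x ^ i)"
  by (intro bounded_test_continuous continuous_intros)

lemma mean_poly_tendsto:
  "((\<lambda>s. laplace_mean a l (\<lambda>x. \<Sum>i\<le>(n::nat). c i * x ^ i) s)
     \<longlongrightarrow> (\<Sum>i\<le>n. c i * real (Suc i) powr (- \<rho>))) (at_right 0)"
proof (rule Lim_transform_eventually)
  show "((\<lambda>s. \<Sum>i\<le>n. c i * laplace_mean a l (\<lambda>x. x ^ i) s)
     \<longlongrightarrow> (\<Sum>i\<le>n. c i * real (Suc i) powr (- \<rho>))) (at_right 0)"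
    by (intro tendsto_intros mean_power_tendsto)
  have eq: "laplace_mean a l (\<lambda>x. \<Sum>i\<le>n. c i * x ^ i) s = (\<Sum>i\<le>n. c i * laplace_mean a l (\<lambda>x. x ^ i) s)"
    if "s > 0" for s n
  proof (induction n)
    case 0 show ?case using mean_cmult[OF that, of "\<lambda>_. 1" "c 0"] by simp
  next
    case (Suc n)
    then show ?case
      using mean_add[OF that bounded_test_poly[of c n] bounded_test_cmult[OF bounded_test_power, of "c (Suc n)" "Suc n"]]
        mean_cmult[OF that bounded_test_power, of "c (Suc n)" "Suc n"]
      by simp
  qed
  show "\<forall>\<^sub>F s in at_right 0. (\<Sum>i\<le>n. c i * laplace_mean a l (\<lambda>x. x ^ i) s)
      = laplace_mean a l (\<lambda>x. \<Sum>i\<le>n. c i * x ^ i) s"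
    using eventually_at_right_less[of "0::real"] by eventually_elim (simp add: eq)
qed

end

locale laplace_family_pair = A: laplace_family a l \<rho> + B: laplace_family b m \<rho> for a l b m \<rho>
begin

text \<open>The limits of all polynomial means depend on \<rho> alone, hence agree for both
  families. A Weierstrass polynomial within e/4 of g costs e/4 in each family, since means are
  monotone and reproduce constants.\<close>

lemma mean_difference_continuous:
  assumes "continuous_on {0..1} g"
  shows "((\<lambda>s. laplace_mean a l g s - laplace_mean b m g s) \<longlongrightarrow> 0) (at_right 0)"
proof (rule tendstoI)
  fix e :: real assume e: "e > 0"
  obtain p where p: "real_polynomial_function p" "\<And>x. x \<in> {0..1} \<Longrightarrow> \<bar>g x - p x\<bar> < e / 4"
    using Stone_Weierstrass_real_polynomial_function[OF _ assms, of "e / 4"] e by auto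
  then obtain c n where pc: "p = (\<lambda>x. \<Sum>i\<le>n. c i * x ^ i)"
    by (auto simp: real_polynomial_function_iff_sum)
  have bg: "bounded_test g" using assms by (rule bounded_test_continuous)
  have bp: "bounded_test p" unfolding pc by (rule A.bounded_test_poly)
  have "((\<lambda>s. laplace_mean a l p s - laplace_mean b m p s) \<longlongrightarrow> 0) (at_right 0)"
    using tendsto_diff[OF A.mean_poly_tendsto[of c n] B.mean_poly_tendsto[of c n]] by (simp add: pc)
  then have "\<forall>\<^sub>F s in at_right 0. \<bar>laplace_mean a l p s - laplace_mean b m p s\<bar> < e / 2"
    using e by (auto dest!: tendstoD[of _ _ _ "e / 2"])
  then show "\<forall>\<^sub>F s in at_right 0. dist (laplace_mean a l g s - laplace_mean b m g s) 0 < e"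
    using eventually_at_right_less[of "0::real"]
  proof eventually_elim
    case (elim s)
    have bs: "bounded_test (\<lambda>x. p x + d)" for d using bp by auto
    have le: "g x \<le> p x + e / 4" "p x + - (e / 4) \<le> g x" if "0 < x" "x \<le> 1" for x
    proof -
      have "\<bar>g x - p x\<bar> < e / 4" using p(2)[of x] that by simp
      then show "g x \<le> p x + e / 4" "p x + - (e / 4) \<le> g x" by linarith+
    qed
    have "laplace_mean a l g s \<le> laplace_mean a l p s + e / 4" "laplace_mean a l p s - e / 4 \<le> laplace_mean a l g s"
      using A.mean_mono[OF elim(2) bg bs le(1)] A.mean_mono[OF elim(2) bs bg le(2)]
        A.mean_add[OF elim(2) bp, of "\<lambda>_. e / 4"] A.mean_add[OF elim(2) bp, of "\<lambda>_. - (e / 4)"]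
        A.mean_const[OF elim(2)] by auto
    moreover have "laplace_mean b m g s \<le> laplace_mean b m p s + e / 4" "laplace_mean b m p s - e / 4 \<le> laplace_mean b m g s"
      using B.mean_mono[OF elim(2) bg bs le(1)] B.mean_mono[OF elim(2) bs bg le(2)]
        B.mean_add[OF elim(2) bp, of "\<lambda>_. e / 4"] B.mean_add[OF elim(2) bp, of "\<lambda>_. - (e / 4)"]
        B.mean_const[OF elim(2)] by auto
    ultimately show ?case using elim(1) unfolding dist_real_def by arith
  qed
qed

text \<open>The step at 1 is compared with a step at a nearby level y through a ramp lying between
  them. Only the ramp has to be moved from one family to the other; continuity of \<Phi> at 1 then
  lets y tend to 1. This is why the model must be known at all levels y, the target family at
  none.\<close>

lemma mean_step_tendsto:
  assumes lim: "\<And>y. y > 0 \<Longrightarrow> ((\<lambda>s. laplace_mean b m (step_test y) s) \<longlongrightarrow> \<Phi> y) (at_right 0)"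
    and cont: "isCont \<Phi> 1"
  shows "((\<lambda>s. laplace_mean a l (step_test 1) s) \<longlongrightarrow> \<Phi> 1) (at_right 0)"
proof -
  have ramp_cont: "continuous_on {0..1} (ramp (exp (- z)) (exp (- y)))" if "y < z" for y z :: real
    using that by (intro continuous_on_ramp) auto
  show ?thesis
  proof (rule order_tendstoI)
    fix c assume "c < \<Phi> 1"
    then have "\<forall>\<^sub>F y in at_left 1. c < \<Phi> y"
      using cont by (metis order_tendstoD(1) isCont_def filterlim_at_split)
    moreover have "\<forall>\<^sub>F y in at_left 1. (0::real) < y \<and> y < (1::real)"
      using eventually_at_left_real[of 0 1] by (auto elim: eventually_mono)
    ultimately have "\<forall>\<^sub>F y in at_left 1. c < \<Phi> y \<and> 0 < y \<and> y < 1"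
      by (rule eventually_conj)
    then obtain y where y: "c < \<Phi> y" "0 < y" "y < 1"
      using eventually_happens'[OF trivial_limit_at_left_real] by blast
    \<comment> \<open>For y < 1: \<open>step_test y\<close> <= ramp <=
      \<open>step_test 1\<close>.\<close>
    let ?r = "ramp (exp (- 1)) (exp (- y))"
    have "((\<lambda>s. laplace_mean b m (step_test y) s + (laplace_mean a l ?r s - laplace_mean b m ?r s))
        \<longlongrightarrow> \<Phi> y + 0) (at_right 0)"
      using y by (intro tendsto_add lim mean_difference_continuous ramp_cont) auto
    then have "\<forall>\<^sub>F s in at_right 0. c < laplace_mean b m (step_test y) s + (laplace_mean a l ?r s - laplace_mean b m ?r s)"
      using y by (auto dest: order_tendstoD(1))
    then show "\<forall>\<^sub>F s in at_right 0. c < laplace_mean a l (step_test 1) s"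
      using eventually_at_right_less[of "0::real"]
    proof eventually_elim
      case (elim s)
      have br: "bounded_test ?r" using y by (intro bounded_test_continuous ramp_cont)
      show ?case
        using elim(1) A.mean_mono[OF elim(2) br bounded_test_step step_le_ramp(2)[OF y(3)]]
          B.mean_mono[OF elim(2) bounded_test_step br step_le_ramp(1)[OF y(3)]]
        by linarith
    qed
  next
    fix c assume "c > \<Phi> 1"
    then have "\<forall>\<^sub>F y in at_right 1. c > \<Phi> y"
      using cont by (metis order_tendstoD(2) isCont_def filterlim_at_split)
    moreover have "\<forall>\<^sub>F y in at_right 1. y > (1::real)"
      by (rule eventually_at_right_less)
    ultimately have "\<forall>\<^sub>F y in at_right 1. c > \<Phi> y \<and> y > 1"
      by (rule eventually_conj)
    then obtain y where y: "c > \<Phi> y" "y > 1"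
      using eventually_happens'[OF trivial_limit_at_right_real] by blast
    let ?r = "ramp (exp (- y)) (exp (- 1))"
    have "((\<lambda>s. laplace_mean b m (step_test y) s + (laplace_mean a l ?r s - laplace_mean b m ?r s))
        \<longlongrightarrow> \<Phi> y + 0) (at_right 0)"
      using y by (intro tendsto_add lim mean_difference_continuous ramp_cont) auto
    then have "\<forall>\<^sub>F s in at_right 0. c > laplace_mean b m (step_test y) s + (laplace_mean a l ?r s - laplace_mean b m ?r s)"
      using y by (auto dest: order_tendstoD(2))
    then show "\<forall>\<^sub>F s in at_right 0. c > laplace_mean a l (step_test 1) s"
      using eventually_at_right_less[of "0::real"]
    proof eventually_elim
      case (elim s)
      have br: "bounded_test ?r" using y by (intro bounded_test_continuous ramp_cont)
      show ?case
        using elim(1) A.mean_mono[OF elim(2) bounded_test_step br step_le_ramp(1)[OF y(2)]]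
          B.mean_mono[OF elim(2) br bounded_test_step step_le_ramp(2)[OF y(2)]]
        by linarith
    qed
  qed
qed

end

section \<open>The binomial model family\<close>

lemma filterlim_floor_recip:
  assumes "y > 0"
  shows "filterlim (\<lambda>s. nat \<lfloor>y / s\<rfloor>) sequentially (at_right (0::real))"
proof -
  have "filterlim (\<lambda>s. y / s) at_top (at_right (0::real))"
    using assms by real_asymp
  then show ?thesis
    by (intro filterlim_compose[OF filterlim_nat_sequentially]
              filterlim_compose[OF filterlim_floor_sequentially])
qed

lemma floor_recip_ratio:
  assumes "y > 0"
  shows "((\<lambda>s. real (nat \<lfloor>y / s\<rfloor>) * s) \<longlongrightarrow> y) (at_right (0::real))"
proof (rule tendsto_sandwich)
  show "\<forall>\<^sub>F s in at_right 0. y - s \<le> real (nat \<lfloor>y / s\<rfloor>) * s"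
    using eventually_at_right_less[of "0::real"]
  proof eventually_elim
    case (elim s)
    have "y / s - 1 \<le> real (nat \<lfloor>y / s\<rfloor>)" by linarith
    then have "(y / s - 1) * s \<le> real (nat \<lfloor>y / s\<rfloor>) * s" using elim by (intro mult_right_mono) auto
    moreover have "(y / s - 1) * s = y - s" using elim by (simp add: left_diff_distrib)
    ultimately show ?case by simp
  qed
  show "\<forall>\<^sub>F s in at_right 0. real (nat \<lfloor>y / s\<rfloor>) * s \<le> y"
    using eventually_at_right_less[of "0::real"]
  proof eventually_elim
    case (elim s)
    have "real (nat \<lfloor>y / s\<rfloor>) \<le> y / s" using assms elim by simp
    then show ?case using elim by (simp add: field_simps)
  qed
  show "((\<lambda>s. y - s) \<longlongrightarrow> y) (at_right 0)" by (auto intro!: tendsto_eq_intros)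
qed auto

lemma nat_floor_recip_iff:
  assumes "s > 0" "y > 0"
  shows "exp (- y) \<le> exp (- (s * real n)) \<longleftrightarrow> n \<le> nat \<lfloor>y / s\<rfloor>"
proof -
  have "exp (- y) \<le> exp (- (s * real n)) \<longleftrightarrow> real n \<le> y / s"
    using assms by (simp add: field_simps)
  also have "\<dots> \<longleftrightarrow> n \<le> nat \<lfloor>y / s\<rfloor>"
    using assms by (simp add: le_nat_floor le_nat_iff le_floor_iff)
  finally show ?thesis .
qed

text \<open>The n-th Taylor coefficient of (1 - x)^(-\<theta>), evaluated later at x =
  e^(-s).\<close>

definition binomial_weight :: "real \<Rightarrow> nat \<Rightarrow> real" where
  "binomial_weight \<theta> n = pochhammer \<theta> n / fact n"

lemma binomial_weight_one: "binomial_weight 1 = (\<lambda>_. 1)"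
  by (simp add: binomial_weight_def fun_eq_iff flip: pochhammer_fact)

lemma binomial_weight_sums:
  assumes "s > 0"
  shows "(\<lambda>n. binomial_weight \<theta> n * exp (- (s * real n))) sums ((1 - exp (- s)) powr (- \<theta>))"
proof -
  have "(\<lambda>n. ((- \<theta>) gchoose n) * (- exp (- s)) ^ n) sums (1 + (- exp (- s))) powr (- \<theta>)"
    using assms by (intro gen_binomial_real) simp
  moreover have "((- \<theta>) gchoose n) * (- exp (- s)) ^ n = binomial_weight \<theta> n * exp (- (s * real n))" for n
  proof -
    have "((- \<theta>) gchoose n) * (- exp (- s)) ^ n = ((-1) ^ n * (-1) ^ n) * (pochhammer \<theta> n / fact n * exp (- s) ^ n)"
      unfolding gbinomial_pochhammer by (subst power_minus) simp
    also have "(-1::real) ^ n * (-1) ^ n = 1" by (simp flip: power_add mult_2)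
    finally show ?thesis
      by (simp add: binomial_weight_def mult.commute[of s] flip: exp_of_nat_mult)
  qed
  ultimately show ?thesis by simp
qed

lemma laplace_sum_binomial_weight:
  assumes "s > 0"
  shows "laplace_sum (binomial_weight \<theta>) real (\<lambda>_. 1) s = (1 - exp (- s)) powr (- \<theta>)"
  using sums_unique[OF binomial_weight_sums[OF assms, of \<theta>]] by (simp add: laplace_sum_def)

lemma binomial_family:
  assumes "\<theta> > 0"
  shows "laplace_family (binomial_weight \<theta>) real \<theta>"
proof
  show "binomial_weight \<theta> n \<ge> 0" for n
    using assms by (simp add: binomial_weight_def pochhammer_nonneg)
  show "summable (\<lambda>n. binomial_weight \<theta> n * exp (- (s * real n)))" if "s > 0" for s
    using binomial_weight_sums[OF that] by (rule sums_summable)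
  show "laplace_sum (binomial_weight \<theta>) real (\<lambda>_. 1) s > 0" if "s > 0" for s
    using that by (simp add: laplace_sum_binomial_weight)
  fix j :: nat assume j: "j \<ge> 1"
  have "((\<lambda>s. ((1 - exp (- (real j * s))) / (1 - exp (- s))) powr (- \<theta>)) \<longlongrightarrow> real j powr (- \<theta>)) (at_right 0)"
  proof (rule tendsto_powr)
    show "((\<lambda>s. (1 - exp (- (real j * s))) / (1 - exp (- s))) \<longlongrightarrow> real j) (at_right 0)"
      using j by real_asymp
  qed (use j in auto)
  then show "((\<lambda>s. laplace_sum (binomial_weight \<theta>) real (\<lambda>_. 1) (real j * s) /
      laplace_sum (binomial_weight \<theta>) real (\<lambda>_. 1) s) \<longlongrightarrow> real j powr (- \<theta>)) (at_right 0)"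
  proof (rule Lim_transform_eventually)
    show "\<forall>\<^sub>F s in at_right 0. ((1 - exp (- (real j * s))) / (1 - exp (- s))) powr (- \<theta>) =
        laplace_sum (binomial_weight \<theta>) real (\<lambda>_. 1) (real j * s) / laplace_sum (binomial_weight \<theta>) real (\<lambda>_. 1) s"
      using eventually_at_right_less[of "0::real"]
    proof eventually_elim
      case (elim s)
      have "real j * s > 0" using elim j by simp
      then show ?case using elim by (simp add: laplace_sum_binomial_weight powr_divide)
    qed
  qed
qed simp

text \<open>Summing coefficients multiplies the generating function by 1 / (1 - x), so the result is
  the N-th coefficient of (1 - x)^(-\<theta> - 1).\<close>

lemma sum_binomial_weight: "(\<Sum>n\<le>N. binomial_weight \<theta> n) = pochhammer (\<theta> + 1) N / fact N"
proof (induction N)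
  case (Suc N)
  have *: "pochhammer \<theta> (Suc N) = \<theta> * pochhammer (\<theta> + 1) N" by (rule pochhammer_rec)
  have **: "pochhammer (\<theta> + 1) (Suc N) = pochhammer (\<theta> + 1) N * (\<theta> + 1 + real N)"
    by (simp add: pochhammer_rec' mult.commute)
  show ?case
    unfolding sum.atMost_Suc Suc.IH unfolding ** binomial_weight_def * fact_Suc
    by (simp add: divide_simps del: of_nat_Suc) (simp add: algebra_simps)
qed (simp add: binomial_weight_def)

text \<open>The quotient is the reciprocal of Euler's approximation \<open>Gamma_series'\<close> at
  \<theta> + 1; the additional factor N in N^(\<theta> + 1) turns its (N - 1)! into N!.\<close>

lemma sum_binomial_weight_asymp:
  assumes "\<theta> > 0"
  shows "(\<lambda>N. (\<Sum>n\<le>N. binomial_weight \<theta> n) / real N powr \<theta>) \<longlonglongrightarrow> 1 / Gamma (\<theta> + 1)"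
proof -
  have "(\<lambda>N. Gamma_series' (\<theta> + 1) N) \<longlonglongrightarrow> Gamma (\<theta> + 1)"
    by (rule Gamma_series'_LIMSEQ)
  then have lim: "(\<lambda>N. 1 / Gamma_series' (\<theta> + 1) N) \<longlonglongrightarrow> 1 / Gamma (\<theta> + 1)"
    using assms Gamma_real_pos[of "\<theta> + 1"] by (intro tendsto_intros) linarith+
  have "\<forall>\<^sub>F N in sequentially. 1 / Gamma_series' (\<theta> + 1) N
      = (\<Sum>n\<le>N. binomial_weight \<theta> n) / real N powr \<theta>"
    using eventually_gt_at_top[of 0]
  proof eventually_elim
    case (elim N)
    then show ?case
      by (simp add: sum_binomial_weight Gamma_series'_def powr_def exp_add ring_distribs fact_reduce)
  qed
  then show ?thesis using Lim_transform_eventually[OF lim] by simp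
qed

text \<open>The step test keeps precisely n <= m with m the floor of y / s, and the total mass is (1
  - e^(-s))^(-\<theta>). The mean splits into the normalised partial sum, (m s)^\<theta> with m s
  tending to y, and a factor tending to 1.\<close>

lemma mean_step_binomial:
  assumes "\<theta> > 0" "y > 0"
  shows "((\<lambda>s. laplace_mean (binomial_weight \<theta>) real (step_test y) s) \<longlongrightarrow> y powr \<theta> / Gamma (\<theta> + 1)) (at_right 0)"
proof -
  let ?m = "\<lambda>s. nat \<lfloor>y / s\<rfloor>" and ?S = "\<lambda>N. \<Sum>n\<le>N. binomial_weight \<theta> n"
  have "((\<lambda>s::real. (1 - exp (- s)) / s) \<longlongrightarrow> 1) (at_right 0)" by real_asymp
  then have "((\<lambda>s. ?S (?m s) / real (?m s) powr \<theta> * (real (?m s) * s) powr \<theta> * ((1 - exp (- s)) / s) powr \<theta>)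
      \<longlongrightarrow> (1 / Gamma (\<theta> + 1)) * y powr \<theta> * 1 powr \<theta>) (at_right 0)"
    using assms
    by (intro tendsto_mult tendsto_powr floor_recip_ratio
          filterlim_compose[OF sum_binomial_weight_asymp filterlim_floor_recip]) auto
  then show ?thesis
  proof (rule Lim_transform_eventually[OF tendsto_eq_rhs])
    show "1 / Gamma (\<theta> + 1) * y powr \<theta> * 1 powr \<theta> = y powr \<theta> / Gamma (\<theta> + 1)" by simp
    show "\<forall>\<^sub>F s in at_right 0. ?S (?m s) / real (?m s) powr \<theta> * (real (?m s) * s) powr \<theta> * ((1 - exp (- s)) / s) powr \<theta>
        = laplace_mean (binomial_weight \<theta>) real (step_test y) s"
      using eventually_at_right_real[OF assms(2)]
    proof eventually_elim
      case (elim s)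
      define k where "k = ?m s"
      \<comment> \<open>Restricting to s < y ensures k >= 1, so that k^\<theta> may be
        cancelled.\<close>
      have m: "k > 0" using elim by (simp add: field_simps k_def)
      have "laplace_sum (binomial_weight \<theta>) real (step_test y) s = (\<Sum>n. if n \<in> {..k} then binomial_weight \<theta> n else 0)"
        unfolding laplace_sum_def
        using elim by (intro suminf_cong) (auto simp: step_test_def nat_floor_recip_iff k_def simp del: exp_le_cancel_iff)
      also have "\<dots> = ?S k" by (subst suminf_finite[of "{..k}"]) auto
      finally show ?case using elim m unfolding k_def[symmetric]
        by (simp add: laplace_mean_def laplace_sum_binomial_weight powr_mult powr_divide powr_minus field_simps)
    qed
  qed
qed

theorem laplace_tauberian:
  assumes "laplace_family a l \<theta>" "\<theta> > 0"
  shows "((\<lambda>s. laplace_mean a l (step_test 1) s) \<longlongrightarrow> 1 / Gamma (\<theta> + 1)) (at_right 0)"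
proof -
  interpret A: laplace_family a l \<theta> by fact
  interpret B: laplace_family "binomial_weight \<theta>" real \<theta> using assms(2) by (rule binomial_family)
  interpret laplace_family_pair a l "binomial_weight \<theta>" real \<theta> ..
  have "isCont (\<lambda>y. y powr \<theta> / Gamma (\<theta> + 1)) 1"
    using assms(2) Gamma_real_pos[of "\<theta> + 1"] by (intro continuous_intros) (auto simp: less_le)
  then show ?thesis
    using mean_step_tendsto[OF mean_step_binomial[OF assms(2)]] by simp
qed

text \<open>Allows test functions with one jump: the continuous part moves between families by
  approximation, and the step has the mean limit 1 / Gamma 2 in both.\<close>

lemma mean_limit_transfer:
  assumes "laplace_family a l 1" "continuous_on {0..1} \<phi>"
    and lim: "((\<lambda>s. laplace_mean (\<lambda>_. 1) real (\<lambda>x. \<phi> x + c * step_test 1 x) s) \<longlongrightarrow> L) (at_right 0)"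
  shows "((\<lambda>s. laplace_mean a l (\<lambda>x. \<phi> x + c * step_test 1 x) s) \<longlongrightarrow> L) (at_right 0)"
proof -
  interpret A: laplace_family a l 1 by fact
  interpret B: laplace_family "\<lambda>_. 1" real 1 using binomial_family[of 1] by (simp add: binomial_weight_one)
  interpret laplace_family_pair a l "\<lambda>_. 1" real 1 ..
  let ?M = "\<lambda>g s. laplace_mean a l g s - laplace_mean (\<lambda>_. 1) real g s"
  have "(?M (step_test 1) \<longlongrightarrow> 1 / Gamma (1 + 1) - 1 / Gamma (1 + 1)) (at_right 0)"
    by (intro tendsto_diff laplace_tauberian A.laplace_family_axioms B.laplace_family_axioms) auto
  then have "((\<lambda>s. laplace_mean (\<lambda>_. 1) real (\<lambda>x. \<phi> x + c * step_test 1 x) s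
      + (?M \<phi> s + c * ?M (step_test 1) s)) \<longlongrightarrow> L + (0 + c * 0)) (at_right 0)"
    by (intro tendsto_add tendsto_mult[OF tendsto_const] lim mean_difference_continuous[OF assms(2)]) simp
  then show ?thesis
  proof (rule Lim_transform_eventually[OF tendsto_eq_rhs])
    have b: "bounded_test \<phi>" "bounded_test (\<lambda>x. c * step_test 1 x)"
      using assms(2) bounded_test_step by (auto intro: bounded_test_continuous)
    show "\<forall>\<^sub>F s in at_right 0. laplace_mean (\<lambda>_. 1) real (\<lambda>x. \<phi> x + c * step_test 1 x) s
      + (?M \<phi> s + c * ?M (step_test 1) s) = laplace_mean a l (\<lambda>x. \<phi> x + c * step_test 1 x) s"
      using eventually_at_right_less[of "0::real"]
    proof eventually_elim
      case (elim s)
      show ?case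
        by (simp only: A.mean_add[OF elim b] B.mean_add[OF elim b] A.mean_cmult[OF elim bounded_test_step]
            B.mean_cmult[OF elim bounded_test_step]) (simp add: algebra_simps)
    qed
  qed simp
qed

section \<open>Test functions for sums over primes\<close>

text \<open>The logarithmic mean of 1 and x; at x = e^(-t) it is (1 - e^(-t)) / t. The values at 0
  and 1 are the continuous extensions, required for approximation on the closed interval.\<close>

definition log_mean :: "real \<Rightarrow> real" where
  "log_mean x = (if x \<le> 0 then 0 else if x = 1 then 1 else (x - 1) / ln x)"

lemma continuous_on_log_mean: "continuous_on {0..1} log_mean"
proof -
  have "(log_mean \<longlongrightarrow> log_mean x) (at x within {0..1})" if x: "x \<in> {0..1}" for x
  proof -
    consider "x = 0" | "0 < x" "x < 1" | "x = 1" using x by force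
    then show ?thesis
    proof cases
      case 1
      have "((\<lambda>x::real. (x - 1) / ln x) \<longlongrightarrow> 0) (at_right 0)" by real_asymp
      moreover have "\<forall>\<^sub>F x in at_right (0::real). (x - 1) / ln x = log_mean x"
        using eventually_at_right_real[of 0 1] by (auto elim!: eventually_mono simp: log_mean_def)
      ultimately have "(log_mean \<longlongrightarrow> 0) (at_right 0)" by (rule Lim_transform_eventually)
      then show ?thesis using 1 by (auto simp: log_mean_def at_within_Icc_at_right)
    next
      case 2
      have "((\<lambda>x. (x - 1) / ln x) \<longlongrightarrow> (x - 1) / ln x) (at x)"
        using 2 by (intro tendsto_intros) auto
      moreover have "\<forall>\<^sub>F x in at x. (x - 1) / ln x = log_mean x"
        using eventually_at_in_open'[of "{0<..<1}" x] 2 by (auto elim!: eventually_mono simp: log_mean_def)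
      ultimately have "(log_mean \<longlongrightarrow> (x - 1) / ln x) (at x)" by (rule Lim_transform_eventually)
      then show ?thesis using 2 by (auto simp: log_mean_def intro: tendsto_within_subset)
    next
      case 3
      have "((\<lambda>x::real. (x - 1) / ln x) \<longlongrightarrow> 1) (at_left 1)" by real_asymp
      moreover have "\<forall>\<^sub>F x in at_left (1::real). (x - 1) / ln x = log_mean x"
        using eventually_at_left_real[of 0 1] by (auto elim!: eventually_mono simp: log_mean_def)
      ultimately have "(log_mean \<longlongrightarrow> 1) (at_left 1)" by (rule Lim_transform_eventually)
      then show ?thesis using 3 by (auto simp: log_mean_def at_within_Icc_at_left)
    qed
  qed
  then show ?thesis by (simp add: continuous_on_def)
qed

text \<open>At x = e^(-t), multiplied by x, this is Frullani's integrand (e^(-jt) - e^(-t)) / t,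
  with integral - ln j over t > 0. Writing it with a geometric sum shows continuity up to x =
  1.\<close>

definition frullani_test :: "nat \<Rightarrow> real \<Rightarrow> real" where
  "frullani_test j x = - log_mean x * (\<Sum>i<j - 1. x ^ i)"

lemma continuous_on_frullani_test: "continuous_on {0..1} (frullani_test j)"
  unfolding frullani_test_def by (intro continuous_intros continuous_on_log_mean)

lemma frullani_test_exp:
  assumes "t > 0" "j \<ge> 1"
  shows "exp (- t) * frullani_test j (exp (- t)) = (exp (- (real j * t)) - exp (- t)) / t"
proof -
  have "exp (- t) \<noteq> 1" using assms by simp
  then have "frullani_test j (exp (- t)) = (exp (- t) ^ (j - 1) - 1) / t"
    using assms by (simp add: frullani_test_def log_mean_def geometric_sum)
  moreover have "exp (- t) * exp (- t) ^ (j - 1) = exp (- (real j * t))"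
    using assms by (subst power_Suc[symmetric]) (simp flip: exp_of_nat_mult)
  ultimately show ?thesis by (simp add: right_diff_distrib)
qed

text \<open>
  Both pieces agree at \<open>exp (- 1)\<close>; subtracting \<open>step_test 1\<close> from this continuous function
  leaves \<open>(x - of_bool (exp (- 1) \<le> x)) / (- x * ln x)\<close> on \<open>{0<..<1}\<close>.
\<close>
definition euler_part :: "real \<Rightarrow> real" where
  "euler_part x = (if exp (- 1) \<le> x then (1 - log_mean x) / x else log_mean x / (1 - x))"

lemma continuous_on_euler_part: "continuous_on {0..1} euler_part"
proof -
  have e: "exp (- 1) < (1::real)" "0 < exp (- 1 :: real)" by auto
  have "continuous_on ({exp (- 1)..1} \<union> {0..exp (- 1)})
      (\<lambda>x. if exp (- 1) \<le> x then (1 - log_mean x) / x else log_mean x / (1 - x))"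
  proof (rule continuous_on_cases)
    show "continuous_on {exp (- 1)..1} (\<lambda>x. (1 - log_mean x) / x)"
      using e by (intro continuous_intros continuous_on_subset[OF continuous_on_log_mean])
        (auto intro: order_trans[OF less_imp_le[OF e(2)]] dest: order.strict_trans2)
    show "continuous_on {0..exp (- 1)} (\<lambda>x. log_mean x / (1 - x))"
      using e by (intro continuous_intros continuous_on_subset[OF continuous_on_log_mean])
        (auto intro: order_trans[OF _ less_imp_le[OF e(1)]] dest: order.strict_trans2)
    \<comment> \<open>Both sides equal 1, because \<open>log_mean (exp (- 1))\<close> is 1 -
      e^(-1).\<close>
    have "(1 - log_mean (exp (- 1))) / exp (- 1) = log_mean (exp (- 1)) / (1 - exp (- 1))"
      using e by (simp add: log_mean_def)
    then show "\<forall>x. x \<in> {exp (- 1)..1} \<and> \<not> exp (- 1) \<le> x \<or> x \<in> {0..exp (- 1)} \<and> exp (- 1) \<le> x \<longrightarrow>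
        (1 - log_mean x) / x = log_mean x / (1 - x)"
      by (metis atLeastAtMost_iff order_antisym)
  qed auto
  moreover have "{exp (- 1)..1} \<union> {0..exp (- 1)} = {0..1::real}"
    using ivl_disj_un_two_touch(4)[of 0 "exp (- 1)" "1::real"] e by (simp add: Un_commute less_imp_le)
  ultimately show ?thesis unfolding euler_part_def by simp
qed

text \<open>At x = e^(-t), multiplied by x, this is the soft cutoff minus the sharp one over t, a
  classical integrand for the negative of Euler's constant. The form continuous part plus multiple
  of a step is the one \<open>mean_limit_transfer\<close> accepts.\<close>

definition euler_test :: "real \<Rightarrow> real" where
  "euler_test x = euler_part x + (- 1) * step_test 1 x"

lemma euler_test_exp:
  assumes "t > 0"
  shows "exp (- t) * euler_test (exp (- t)) = (exp (- t) - of_bool (t \<le> 1)) / t"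
  using assms by (auto simp: euler_test_def euler_part_def step_test_def log_mean_def field_simps)

lemma laplace_sum_one: "s > 0 \<Longrightarrow> laplace_sum (\<lambda>_. 1) real (\<lambda>_. 1) s = 1 / (1 - exp (- s))"
  using laplace_sum_binomial_weight[of s 1]
  by (simp add: binomial_weight_one powr_minus_divide)

lemma log_series_exp:
  assumes "s > 0"
  shows "(\<lambda>n. exp (- (s * real n)) / (s * real n)) sums (- ln (1 - exp (- s)) / s)"
proof -
  have "(\<lambda>n. - ((- (- exp (- s))) ^ n) / real n) sums ln (1 + - exp (- s))"
    using assms by (intro ln_series') simp
  from sums_mult[OF this, of "- 1 / s"] show ?thesis
    by (simp add: exp_of_nat_mult[symmetric] mult.commute)
qed

text \<open>For weights 1 and exponents n, both exponentials sum to logarithmic series. After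
  normalisation the main term is (1 - e^(-s)) / s times ln of (1 - e^(-s)) / (1 - e^(-js)), which
  tends to - ln j.\<close>

lemma frullani_mean_model:
  assumes "j \<ge> 1"
  shows "((\<lambda>s. laplace_mean (\<lambda>_. 1) real (frullani_test j) s) \<longlongrightarrow> - ln (real j)) (at_right 0)"
proof -
  have j: "real j > 0" using assms by simp
  have "((\<lambda>s. (1 - exp (- s)) * (frullani_test j 1 + (ln (1 - exp (- s)) - ln (1 - exp (- (real j * s)))) / s))
      \<longlongrightarrow> - ln (real j)) (at_right 0)"
    using j by real_asymp
  then show ?thesis
  proof (rule Lim_transform_eventually)
    show "\<forall>\<^sub>F s in at_right 0. (1 - exp (- s)) * (frullani_test j 1 + (ln (1 - exp (- s)) - ln (1 - exp (- (real j * s)))) / s)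
      = laplace_mean (\<lambda>_. 1) real (frullani_test j) s"
      using eventually_at_right_less[of "0::real"]
    proof eventually_elim
      case (elim s)
      have js: "real j * s > 0" using elim j by simp
      \<comment> \<open>Division by zero makes the logarithmic series vanish at n = 0, whereas the
        Laplace sum has the term \<open>frullani_test j 1\<close> there. It is added by hand and
        disappears in the limit through the factor 1 - e^(-s).\<close>
      have "(\<lambda>n. (if n = 0 then frullani_test j 1 else 0) + (exp (- (real j * s * real n)) / (real j * s * real n) * real j -
          exp (- (s * real n)) / (s * real n))) sums
          (frullani_test j 1 + (- ln (1 - exp (- (real j * s))) / (real j * s) * real j - - ln (1 - exp (- s)) / s))"
        by (intro sums_add sums_diff sums_mult2 log_series_exp elim js sums_single)
      moreover have "(if n = 0 then frullani_test j 1 else 0) + (exp (- (real j * s * real n)) / (real j * s * real n) * real j -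
          exp (- (s * real n)) / (s * real n)) = 1 * exp (- (s * real n)) * frullani_test j (exp (- (s * real n)))" for n
      proof (cases "n = 0")
        case False
        then have "s * real n > 0" using elim by simp
        from frullani_test_exp[OF this assms] show ?thesis using False j
          by (simp add: diff_divide_distrib mult.assoc)
      qed simp
      ultimately have "laplace_sum (\<lambda>_. 1) real (frullani_test j) s =
          frullani_test j 1 + (- ln (1 - exp (- (real j * s))) / (real j * s) * real j - - ln (1 - exp (- s)) / s)"
        unfolding laplace_sum_def by (simp add: sums_iff)
      then show ?case using j elim
        by (simp add: laplace_mean_def laplace_sum_one diff_divide_distrib mult.commute)
    qed
  qed
qed

text \<open>The soft sum is - ln (1 - e^(-s)) / s, the sharp one a harmonic number over s. Their
  logarithmic growths cancel and leave the defining limit of Euler's constant.\<close>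

lemma euler_mean_model:
  "((\<lambda>s. laplace_mean (\<lambda>_. 1) real euler_test s) \<longlongrightarrow> - euler_mascheroni) (at_right 0)"
proof -
  let ?m = "\<lambda>s::real. nat \<lfloor>1 / s\<rfloor>"
  have l1: "((\<lambda>s::real. (1 - exp (- s)) / s) \<longlongrightarrow> 1) (at_right 0)" "((\<lambda>s::real. 1 - exp (- s)) \<longlongrightarrow> 0) (at_right 0)"
    by real_asymp+
  have "((\<lambda>s. (1 - exp (- s)) * euler_test 1 + (1 - exp (- s)) / s *
      (- ln ((1 - exp (- s)) / s) - (harm (?m s) - ln (real (?m s))) - ln (real (?m s) * s)))
      \<longlongrightarrow> 0 * euler_test 1 + 1 * (- ln 1 - euler_mascheroni - ln 1)) (at_right 0)"
    by (intro tendsto_intros l1 floor_recip_ratio filterlim_compose[OF euler_mascheroni_LIMSEQ filterlim_floor_recip]) auto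
  then show ?thesis
  proof (rule Lim_transform_eventually[OF tendsto_eq_rhs])
    show "\<forall>\<^sub>F s in at_right 0. (1 - exp (- s)) * euler_test 1 + (1 - exp (- s)) / s *
      (- ln ((1 - exp (- s)) / s) - (harm (?m s) - ln (real (?m s))) - ln (real (?m s) * s))
      = laplace_mean (\<lambda>_. 1) real euler_test s"
      using eventually_at_right_real[of 0 1, OF zero_less_one]
    proof eventually_elim
      case (elim s)
      define k where "k = ?m s"
      have k: "k > 0" using elim by (simp add: k_def)
      have iff: "s * real n \<le> 1 \<longleftrightarrow> n \<le> k" for n
        using nat_floor_recip_iff[of s 1 n] elim by (simp add: k_def)
      have "(\<lambda>n. if n \<in> {1..k} then 1 / (s * real n) else 0) sums (\<Sum>n\<in>{1..k}. 1 / (s * real n))"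
        by (intro sums_If_finite_set) auto
      also have "(\<Sum>n\<in>{1..k}. 1 / (s * real n)) = harm k / s"
        by (simp add: harm_def sum_distrib_left divide_inverse mult.commute)
      finally have "(\<lambda>n. (if n = 0 then euler_test 1 else 0) + (exp (- (s * real n)) / (s * real n) -
          (if n \<in> {1..k} then 1 / (s * real n) else 0))) sums (euler_test 1 + (- ln (1 - exp (- s)) / s - harm k / s))"
        using elim by (intro sums_add sums_diff log_series_exp sums_single) auto
      moreover have "(if n = 0 then euler_test 1 else 0) + (exp (- (s * real n)) / (s * real n) -
          (if n \<in> {1..k} then 1 / (s * real n) else 0)) = 1 * exp (- (s * real n)) * euler_test (exp (- (s * real n)))" for n
      proof (cases "n = 0")
        case False
        then have "s * real n > 0" using elim by simp
        from euler_test_exp[OF this] show ?thesis using False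
          by (auto simp: diff_divide_distrib iff)
      qed simp
      ultimately have LS: "laplace_sum (\<lambda>_. 1) real euler_test s =
          euler_test 1 + (- ln (1 - exp (- s)) / s - harm k / s)"
        unfolding laplace_sum_def by (simp add: sums_iff)
      have "ln ((1 - exp (- s)) / s) = ln (1 - exp (- s)) - ln s" "ln (real k * s) = ln (real k) + ln s"
        using k elim by (simp_all add: ln_div ln_mult)
      note logs = this
      show ?case
        using elim unfolding k_def[symmetric] laplace_mean_def LS logs
        by (simp add: laplace_sum_one algebra_simps diff_divide_distrib)
    qed
  qed auto
qed

lemma frullani_mean:
  assumes "laplace_family a l 1" "j \<ge> 1"
  shows "((\<lambda>s. laplace_mean a l (frullani_test j) s) \<longlongrightarrow> - ln (real j)) (at_right 0)"
  using mean_limit_transfer[OF assms(1) continuous_on_frullani_test, of j 0 "- ln (real j)"]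
    frullani_mean_model[OF assms(2)] by simp

lemma euler_mean:
  assumes "laplace_family a l 1"
  shows "((\<lambda>s. laplace_mean a l euler_test s) \<longlongrightarrow> - euler_mascheroni) (at_right 0)"
  using mean_limit_transfer[OF assms continuous_on_euler_part, of "- 1"] euler_mean_model
  by (simp add: euler_test_def[abs_def])

section \<open>Euler products\<close>

definition smooth :: "nat set \<Rightarrow> nat set" where
  "smooth P = {n. n > 0 \<and> (\<forall>p. prime p \<and> p dvd n \<longrightarrow> p \<in> P)}"

locale euler_weight =
  fixes f :: "nat \<Rightarrow> real"
  assumes nonneg: "f n \<ge> 0" and one: "f 1 = 1"
    and mult: "coprime m n \<Longrightarrow> f (m * n) = f m * f n"
begin

text \<open>Adjoining a prime q writes each n uniquely as q^j m with m smooth over P, so the new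
  index set is a product on which the sum factors. Nonnegativity turns iterated summability into
  unconditional summability.\<close>

lemma euler_product_finite:
  assumes "finite P" "P \<subseteq> {p. prime p}" "\<And>p. p \<in> P \<Longrightarrow> (\<lambda>j. f (p ^ j)) sums E p"
  shows "(f has_sum (\<Prod>p\<in>P. E p)) (smooth P)"
  using assms
proof (induction P rule: finite_induct)
  case empty
  have "n \<in> smooth {} \<longleftrightarrow> n = 1" for n
    by (auto simp: smooth_def) (metis One_nat_def not_prime_0 prime_factor_nat)
  then have "smooth {} = {1}" by blast
  then show ?case using has_sum_finite[of "{1}" f] one by simp
next
  case (insert q P)
  have q: "prime q" using insert.prems by auto
  let ?S = "\<lambda>(j, m). q ^ j * m"
  have cop: "coprime (q ^ j) m" if "m \<in> smooth P" for j m
    using that q insert.hyps(2)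
    by (intro coprime_power_left_iff[THEN iffD2] disjI1 prime_imp_coprime) (auto simp: smooth_def)
  have IH: "(f has_sum (\<Prod>p\<in>P. E p)) (smooth P)"
    using insert.prems by (intro insert.IH) auto
  have Eq: "((\<lambda>j. f (q ^ j)) has_sum E q) UNIV"
    using insert.prems nonneg by (intro sums_nonneg_imp_has_sum) auto
  have prod: "((\<lambda>(j, m). f (q ^ j) * f m) has_sum (E q * (\<Prod>p\<in>P. E p))) (UNIV \<times> smooth P)"
  proof (rule has_sum_SigmaI)
    show "((\<lambda>m. case (j, m) of (j, m) \<Rightarrow> f (q ^ j) * f m) has_sum (f (q ^ j) * (\<Prod>p\<in>P. E p))) (smooth P)" for j
      using has_sum_cmult_right[OF IH] by simp
    show "((\<lambda>j. f (q ^ j) * (\<Prod>p\<in>P. E p)) has_sum (E q * (\<Prod>p\<in>P. E p))) UNIV"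
      by (rule has_sum_cmult_left[OF Eq])
    show "(\<lambda>(j, m). f (q ^ j) * f m) summable_on UNIV \<times> smooth P"
    proof (rule summable_on_SigmaI)
      show "((\<lambda>m. case (j, m) of (j, m) \<Rightarrow> f (q ^ j) * f m) has_sum (f (q ^ j) * (\<Prod>p\<in>P. E p))) (smooth P)" for j
        using has_sum_cmult_right[OF IH] by simp
      show "(\<lambda>j. f (q ^ j) * (\<Prod>p\<in>P. E p)) summable_on UNIV"
        using has_sum_cmult_left[OF Eq] by (rule has_sum_imp_summable)
    qed (auto simp: nonneg)
  qed
  have "((\<lambda>x. f (?S x)) has_sum (E q * (\<Prod>p\<in>P. E p))) (UNIV \<times> smooth P)"
    by (rule has_sum_cong[THEN iffD1, OF _ prod]) (auto simp: mult[OF cop])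
  moreover have "bij_betw ?S (UNIV \<times> smooth P) (smooth (insert q P))"
  proof (rule bij_betwI[where g = "\<lambda>n. (multiplicity q n, n div q ^ multiplicity q n)"])
    show "?S \<in> UNIV \<times> smooth P \<rightarrow> smooth (insert q P)"
    proof
      fix x :: "nat \<times> nat" assume "x \<in> UNIV \<times> smooth P"
      then obtain j m where x: "x = (j, m)" "m \<in> smooth P" by auto
      have "p \<in> insert q P" if "prime p" "p dvd q ^ j * m" for p
      proof -
        have "p dvd q ^ j \<or> p dvd m" using that by (simp add: prime_dvd_mult_iff)
        then have "p dvd q \<or> p dvd m" using that(1) prime_dvd_power by blast
        then show ?thesis using that(1) q x(2) primes_dvd_imp_eq by (auto simp: smooth_def)
      qed
      then show "?S x \<in> smooth (insert q P)" using x q by (simp add: smooth_def prime_gt_0_nat)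
    qed
    show "(\<lambda>n. (multiplicity q n, n div q ^ multiplicity q n)) \<in> smooth (insert q P) \<rightarrow> UNIV \<times> smooth P"
    proof
      fix n assume n: "n \<in> smooth (insert q P)"
      then have n0: "n \<noteq> 0" by (simp add: smooth_def)
      have dv: "q ^ multiplicity q n dvd n" by (rule multiplicity_dvd)
      have "\<not> q dvd n div q ^ multiplicity q n"
        using n0 q by (intro multiplicity_decompose) auto
      moreover have "n div q ^ multiplicity q n dvd n" using dv by (metis dvd_div_mult_self dvd_triv_left)
      moreover have "n div q ^ multiplicity q n > 0" using dv n0 by (metis dvd_div_eq_0_iff gr0I)
      ultimately show "(multiplicity q n, n div q ^ multiplicity q n) \<in> UNIV \<times> smooth P"
        using n by (auto simp: smooth_def dest: dvd_trans)
    qed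
    show "(\<lambda>n. (multiplicity q n, n div q ^ multiplicity q n)) (?S x) = x" if xx: "x \<in> UNIV \<times> smooth P" for x
    proof -
      obtain j m where x: "x = (j, m)" "m \<in> smooth P" using xx by auto
      have "\<not> q dvd m" using x q insert.hyps(2) by (auto simp: smooth_def)
      then have "multiplicity q (q ^ j * m) = j"
        using q by (intro multiplicity_eqI) auto
      then show ?thesis using x q by (simp add: prime_gt_0_nat)
    qed
    show "?S ((\<lambda>n. (multiplicity q n, n div q ^ multiplicity q n)) n) = n" for n
      by (simp add: multiplicity_dvd)
  qed
  ultimately have "(f has_sum (E q * (\<Prod>p\<in>P. E p))) (smooth (insert q P))"
    by (subst has_sum_reindex_bij_betw[symmetric])
  then show ?case using insert.hyps by simp
qed

text \<open>The product T N over primes below N squeezes the series: an n < N has only prime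
  divisors below N, so partial sums are at most T N, while T N sums over a subset of
  \<open>smooth P\<close>. Convergence of the product is phrased through logarithms, which is how
  the factors are estimated later.\<close>

lemma euler_product:
  assumes P: "P \<subseteq> {p. prime p}" and E: "\<And>p. p \<in> P \<Longrightarrow> (\<lambda>j. f (p ^ j)) sums E p"
    and pos: "\<And>p. p \<in> P \<Longrightarrow> E p > 0"
    and sm: "summable (\<lambda>p. if p \<in> P then ln (E p) else 0)"
  shows "(\<lambda>n. if n \<in> smooth P then f n else 0) sums exp (\<Sum>p. if p \<in> P then ln (E p) else 0)"
proof -
  define T where "T N = (\<Prod>p\<in>P \<inter> {..<N}. E p)" for N
  define S where "S = exp (\<Sum>p. if p \<in> P then ln (E p) else 0)"
  let ?f = "\<lambda>n. if n \<in> smooth P then f n else 0"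
  have "T N = exp (\<Sum>p<N. if p \<in> P then ln (E p) else 0)" for N
  proof -
    have "(\<Sum>p<N. if p \<in> P then ln (E p) else 0) = (\<Sum>p\<in>P \<inter> {..<N}. ln (E p))"
      by (subst sum.inter_restrict[symmetric]) (auto simp: Int_commute intro: sum.cong)
    then show ?thesis unfolding T_def using pos by (simp add: exp_sum)
  qed
  then have lim: "T \<longlonglongrightarrow> S"
    unfolding S_def using tendsto_exp[OF summable_LIMSEQ[OF sm]] by presburger
  have hs: "(f has_sum T N) (smooth (P \<inter> {..<N}))" for N
    unfolding T_def using P E by (intro euler_product_finite) auto
  have sub: "smooth (P \<inter> {..<N}) \<subseteq> smooth P" for N by (auto simp: smooth_def)
  have le: "(\<Sum>n<N. ?f n) \<le> T N" for N
  proof -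
    have "(\<Sum>n<N. ?f n) = (\<Sum>n\<in>smooth P \<inter> {..<N}. f n)"
      by (subst sum.inter_restrict[symmetric]) (auto simp: Int_commute intro: sum.cong)
    also have "\<dots> \<le> T N"
      by (rule finite_sum_le_has_sum[OF hs]) (auto simp: smooth_def nonneg dest: dvd_imp_le)
    finally show ?thesis .
  qed
  have S_bound: "\<exists>B. \<forall>N. T N \<le> B"
    using lim by (metis convergentI convergent_imp_Bseq BseqD abs_le_D1 real_norm_def Bseq_def)
  then obtain B where B: "\<And>N. T N \<le> B" by blast
  have summ: "summable ?f"
  proof (rule bounded_imp_summable)
    show "(\<Sum>n\<le>N. ?f n) \<le> B" for N
      using order_trans[OF le[of "Suc N"] B] unfolding lessThan_Suc_atMost .
  qed (simp add: nonneg)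
  have has: "(?f has_sum suminf ?f) UNIV"
    using summ nonneg by (intro sums_nonneg_imp_has_sum summable_sums) auto
  then have hasP: "(f has_sum suminf ?f) (smooth P)"
    by (rule has_sum_cong_neutral[THEN iffD1, rotated -1]) auto
  have "T N \<le> suminf ?f" for N
    by (rule has_sum_mono2[OF hs hasP sub]) (auto simp: nonneg)
  then have "S \<le> suminf ?f" using lim by (intro LIMSEQ_le_const2[OF lim]) auto
  moreover have "suminf ?f \<le> S"
    using le by (intro LIMSEQ_le[OF summable_LIMSEQ[OF summ] lim]) auto
  ultimately show ?thesis using summable_sums[OF summ] unfolding S_def by simp
qed

end

section \<open>Weights whose Euler factor at s = 0 is 1 / (1 - 1/p)\<close>

definition prime_series :: "nat set \<Rightarrow> real \<Rightarrow> real" where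
  "prime_series A s = (\<Sum>p. if p \<in> A then real p powr (- 1 - s) else 0)"

lemma summable_prime_series:
  assumes "s > 0"
  shows "summable (\<lambda>p. if p \<in> A then real p powr (- 1 - s) else 0)"
proof (rule summable_comparison_test')
  show "summable (\<lambda>p. real p powr (- 1 - s))"
    using assms by (subst summable_real_powr_iff) auto
qed auto

text \<open>The constant in Mertens' product theorem that accounts for higher prime powers. It
  enters the numerator and the denominator alike and cancels at the end.\<close>

definition euler_correction :: "nat set \<Rightarrow> real" where
  "euler_correction A = (\<Sum>p. if p \<in> A then - ln (1 - 1 / real p) - 1 / real p else 0)"

text \<open>Covers both 1/n and the k-free weight. The bound at primes is an inequality because for
  k = 2 the weight of p is 1 / (p - 1).\<close>

locale mertens_weight = euler_weight +
  assumes prime_ge: "prime p \<Longrightarrow> 1 / real p \<le> f p"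
    and prime_powers: "prime p \<Longrightarrow> (\<lambda>j. f (p ^ j)) sums (1 / (1 - 1 / real p))"
begin

definition euler_factor :: "nat \<Rightarrow> real \<Rightarrow> real" where
  "euler_factor p s = (\<Sum>j. f (p ^ j) * real (p ^ j) powr (- s))"

lemma twist_le:
  assumes "prime p" "s \<ge> 0"
  shows "f (p ^ j) * real (p ^ j) powr (- s) \<le> f (p ^ j)"
proof -
  have "real (p ^ j) \<ge> 1" using assms by (simp add: prime_gt_0_nat Suc_leI del: of_nat_power)
  then have "real (p ^ j) powr (- s) \<le> 1"
    using assms by (simp add: powr_minus_divide ge_one_powr_ge_zero del: of_nat_power)
  then show ?thesis using nonneg mult_left_le by blast
qed

lemma euler_factor_sums:
  assumes "prime p" "s \<ge> 0"
  shows "(\<lambda>j. f (p ^ j) * real (p ^ j) powr (- s)) sums euler_factor p s"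
  unfolding euler_factor_def
proof (rule summable_sums, rule summable_comparison_test')
  show "summable (\<lambda>j. f (p ^ j))" using prime_powers[OF assms(1)] by (rule sums_summable)
  show "norm (f (p ^ j) * real (p ^ j) powr (- s)) \<le> f (p ^ j)" for j
    using twist_le[OF assms, of j] nonneg[of "p ^ j"] by (simp add: abs_mult del: of_nat_power)
qed

text \<open>Subtracting the terms 1 and p^(-1-s) leaves nonnegative quantities that only shrink
  under the twist by p^(-js). Their sum is therefore at most its value at s = 0, namely 1 / (p (p -
  1)), uniformly in s.\<close>

lemma euler_factor_bounds:
  assumes "prime p" "s \<ge> 0"
  shows "1 + real p powr (- 1 - s) \<le> euler_factor p s"
    and "euler_factor p s \<le> 1 + real p powr (- 1 - s) + 2 / real p ^ 2"
proof -
  let ?u = "real p powr (- 1 - s)"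
  have p: "real p \<ge> 2" using prime_ge_2_nat[OF assms(1)] by simp
  have u: "?u = 1 / real p * real p powr (- s)"
    using p by (simp add: powr_diff powr_minus field_simps)
  have ps: "real p powr (- s) \<le> 1"
    using p assms by (simp add: powr_minus_divide ge_one_powr_ge_zero)
  have main: "(\<lambda>j. (if j = 0 then 1 else 0) + (if j = 1 then c else 0)) sums (1 + c)" for c :: real
    by (intro sums_add sums_single)
  show "1 + ?u \<le> euler_factor p s"
  proof (rule sums_le[OF _ main[of ?u] euler_factor_sums[OF assms]])
    show "(if j = 0 then 1 else 0) + (if j = 1 then ?u else 0) \<le> f (p ^ j) * real (p ^ j) powr (- s)" for j
      using mult_right_mono[OF prime_ge[OF assms(1)], of "real p powr (- s)"] p one nonneg[of "p ^ j"]
      unfolding u by (auto intro!: mult_nonneg_nonneg)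
  qed
  have "euler_factor p s - (1 + ?u) \<le> 1 / (1 - 1 / real p) - (1 + 1 / real p)"
  proof (rule sums_le[OF _ sums_diff[OF euler_factor_sums[OF assms] main[of ?u]]
        sums_diff[OF prime_powers[OF assms(1)] main[of "1 / real p"]]])
    fix j
    have "(f p - 1 / real p) * real p powr (- s) \<le> f p - 1 / real p"
      using prime_ge[OF assms(1)] ps by (intro mult_left_le) auto
    then show "f (p ^ j) * real (p ^ j) powr (- s) - ((if j = 0 then 1 else 0) + (if j = 1 then ?u else 0))
        \<le> f (p ^ j) - ((if j = 0 then 1 else 0) + (if j = 1 then 1 / real p else 0))"
      using twist_le[OF assms, of j] one unfolding u by (auto simp: left_diff_distrib)
  qed
  also have "1 / (1 - 1 / real p) - (1 + 1 / real p) = 1 / (real p * (real p - 1))"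
    using p by (simp add: field_simps)
  also have "\<dots> \<le> 2 / real p ^ 2"
    using p by (simp add: field_simps power2_eq_square)
  finally show "euler_factor p s \<le> 1 + ?u + 2 / real p ^ 2" by linarith
qed

text \<open>A majorant free of s, as Tannery's theorem demands. With u = p^(-1-s) <= 1/p, the lower
  side uses u - u^2 <= ln (1 + u), the upper side ln E <= E - 1.\<close>

lemma ln_euler_factor_bound:
  assumes "prime p" "s \<ge> 0"
  shows "\<bar>ln (euler_factor p s) - real p powr (- 1 - s)\<bar> \<le> 2 / real p ^ 2"
proof -
  let ?u = "real p powr (- 1 - s)"
  have p: "real p \<ge> 2" using prime_ge_2_nat[OF assms(1)] by simp
  have u0: "0 \<le> ?u" by simp
  have "?u \<le> real p powr (- 1)" using p assms by (intro powr_mono) auto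
  then have u1: "?u \<le> 1 / real p" using p by (simp add: powr_minus_divide)
  then have u2: "?u ^ 2 \<le> 1 / real p ^ 2" using power_mono[OF u1 u0, of 2] by (simp add: power_divide)
  have u3: "?u \<le> 1" using u1 p by (smt (verit) divide_le_eq_1)
  have E1: "1 + ?u \<le> euler_factor p s" and E2: "euler_factor p s \<le> 1 + ?u + 2 / real p ^ 2"
    using euler_factor_bounds[OF assms] by auto
  have "ln (euler_factor p s) \<le> euler_factor p s - 1"
    using E1 u0 by (intro ln_le_minus_one) linarith
  moreover have "?u - ?u ^ 2 \<le> ln (1 + ?u)"
    using u0 u3 by (rule ln_one_plus_pos_lower_bound)
  moreover have "ln (1 + ?u) \<le> ln (euler_factor p s)"
    using E1 u0 by (subst ln_le_cancel_iff) linarith+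
  moreover have "1 / real p ^ 2 \<le> 2 / real p ^ 2" by (simp add: divide_right_mono)
  ultimately show ?thesis using E2 u2 unfolding abs_le_iff by linarith
qed

lemma euler_factor_tendsto:
  assumes "prime p"
  shows "(euler_factor p \<longlongrightarrow> 1 / (1 - 1 / real p)) (at_right 0)"
proof -
  have "((\<lambda>s. \<Sum>j. f (p ^ j) * real (p ^ j) powr (- s)) \<longlongrightarrow> (\<Sum>j. f (p ^ j))) (at_right 0)"
  proof (rule tannerys_theorem[THEN conjunct2, THEN conjunct2])
    show "((\<lambda>s. f (p ^ j) * real (p ^ j) powr (- s)) \<longlongrightarrow> f (p ^ j)) (at_right 0)" for j
      using assms prime_gt_0_nat[of p]
      by (auto intro!: tendsto_eq_intros simp del: of_nat_power)
    show "\<forall>\<^sub>F (j, s) in sequentially \<times>\<^sub>F at_right 0. norm (f (p ^ j) * real (p ^ j) powr (- s)) \<le> f (p ^ j)"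
      using eventually_prodI[OF eventually_True[of sequentially] eventually_at_right_less[of "0::real"]]
    proof eventually_elim
      case (elim x)
      then show ?case
        using twist_le[OF assms, of "snd x" "fst x"] nonneg[of "p ^ fst x"]
        by (simp add: case_prod_unfold abs_mult del: of_nat_power)
    qed
    show "summable (\<lambda>j. f (p ^ j))" using prime_powers[OF assms] by (rule sums_summable)
  qed simp
  then show ?thesis
    using sums_unique[OF prime_powers[OF assms]] by (simp add: euler_factor_def[abs_def])
qed

definition log_correction :: "nat set \<Rightarrow> real \<Rightarrow> real" where
  "log_correction A s = (\<Sum>p. if p \<in> A then ln (euler_factor p s) - real p powr (- 1 - s) else 0)"

lemma summable_inverse_squares: "summable (\<lambda>p. 2 / real p ^ 2)"
  using summable_mult[OF inverse_power_summable[of 2, where 'a = real], of 2] by (simp add: divide_inverse)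

lemma summable_log_correction:
  assumes "A \<subseteq> {p. prime p}" "s \<ge> 0"
  shows "summable (\<lambda>p. if p \<in> A then ln (euler_factor p s) - real p powr (- 1 - s) else 0)"
  by (rule summable_comparison_test'[OF summable_inverse_squares])
     (use assms ln_euler_factor_bound in auto)

text \<open>The limit does not depend on the weight, since every Euler factor tends to 1 / (1 -
  1/p). This is where the k-free weight becomes interchangeable with 1/n.\<close>

lemma log_correction_tendsto:
  assumes "A \<subseteq> {p. prime p}"
  shows "(log_correction A \<longlongrightarrow> euler_correction A) (at_right 0)"
  unfolding log_correction_def[abs_def] euler_correction_def
proof (rule tannerys_theorem[THEN conjunct2, THEN conjunct2])
  fix p
  show "((\<lambda>s. if p \<in> A then ln (euler_factor p s) - real p powr (- 1 - s) else 0)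
      \<longlongrightarrow> (if p \<in> A then - ln (1 - 1 / real p) - 1 / real p else 0)) (at_right 0)"
  proof (cases "p \<in> A")
    case True
    then have pr: "prime p" using assms by auto
    then have p: "real p \<ge> 2" using prime_ge_2_nat[OF pr] by simp
    have "((\<lambda>s. ln (euler_factor p s) - real p powr (- 1 - s)) \<longlongrightarrow> ln (1 / (1 - 1 / real p)) - real p powr (- 1 - 0)) (at_right 0)"
      using p by (intro tendsto_intros euler_factor_tendsto[OF pr]) auto
    then show ?thesis using True p by (simp add: ln_div powr_minus_divide)
  qed simp
next
  show "\<forall>\<^sub>F (p, s) in sequentially \<times>\<^sub>F at_right 0.
      norm (if p \<in> A then ln (euler_factor p s) - real p powr (- 1 - s) else 0) \<le> 2 / real p ^ 2"
    using eventually_prodI[OF eventually_True[of sequentially] eventually_at_right_less[of "0::real"]]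
  proof eventually_elim
    case (elim x)
    then show ?case
      using assms ln_euler_factor_bound[of "fst x" "snd x"] by (auto simp: case_prod_unfold)
  qed
qed (simp_all add: summable_inverse_squares)

lemma twisted: "euler_weight (\<lambda>n. f n * real n powr (- s))"
  by unfold_locales (use one in \<open>auto simp: nonneg mult powr_mult\<close>)

lemma dirichlet_series_sums:
  assumes "A \<subseteq> {p. prime p}" "s > 0"
  shows "(\<lambda>n. if n \<in> smooth A then f n * real n powr (- s) else 0)
     sums exp (prime_series A s + log_correction A s)"
proof -
  interpret tw: euler_weight "\<lambda>n. f n * real n powr (- s)" by (rule twisted)
  have s: "(\<lambda>p. if p \<in> A then ln (euler_factor p s) else 0) sums (prime_series A s + log_correction A s)"
  proof -
    have "(\<lambda>p. (if p \<in> A then real p powr (- 1 - s) else 0) +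
        (if p \<in> A then ln (euler_factor p s) - real p powr (- 1 - s) else 0)) sums (prime_series A s + log_correction A s)"
      unfolding prime_series_def log_correction_def using assms
      by (intro sums_add summable_sums summable_prime_series summable_log_correction) auto
    moreover have "(if p \<in> A then real p powr (- 1 - s) else 0) +
        (if p \<in> A then ln (euler_factor p s) - real p powr (- 1 - s) else 0) = (if p \<in> A then ln (euler_factor p s) else 0)" for p
      by simp
    ultimately show ?thesis by simp
  qed
  have "(\<lambda>n. if n \<in> smooth A then f n * real n powr (- s) else 0) sums exp (\<Sum>p. if p \<in> A then ln (euler_factor p s) else 0)"
  proof (rule tw.euler_product[OF assms(1)])
    show "(\<lambda>j. f (p ^ j) * real (p ^ j) powr (- s)) sums euler_factor p s" if "p \<in> A" for p
      using that assms by (intro euler_factor_sums) auto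
    show "euler_factor p s > 0" if "p \<in> A" for p
    proof -
      have "prime p" using that assms by auto
      from euler_factor_bounds(1)[OF this, of s] assms show ?thesis
        by (smt (verit) powr_ge_zero)
    qed
  qed (use s in \<open>rule sums_summable\<close>)
  then show ?thesis using s by (simp add: sums_iff)
qed

end

lemma recip_weight: "mertens_weight (\<lambda>n. 1 / real n)"
proof
  fix p :: nat assume p: "prime p"
  have "(\<lambda>j. (1 / real p) ^ j) sums (1 / (1 - 1 / real p))"
    using prime_gt_1_nat[OF p] by (intro geometric_sums) auto
  then show "(\<lambda>j. 1 / real (p ^ j)) sums (1 / (1 - 1 / real p))"
    by (simp add: power_divide)
qed auto

lemma infsum_smooth_recip:
  assumes "finite P" "P \<subseteq> {p. prime p}"
  shows "infsum (\<lambda>n. 1 / real n) (smooth P) = (\<Prod>p\<in>P. 1 / (1 - 1 / real p))"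
proof -
  interpret mertens_weight "\<lambda>n. 1 / real n" by (rule recip_weight)
  show ?thesis using assms prime_powers by (intro infsumI euler_product_finite) auto
qed

text \<open>Taking logarithms of the finite Euler product, the difference is exactly a partial sum
  of the series \<open>euler_correction A\<close>.\<close>

lemma prime_product_asymp:
  assumes "A \<subseteq> {p. prime p}"
  shows "(\<lambda>N. ln (infsum (\<lambda>n. 1 / real n) (smooth (A \<inter> {..N}))) - (\<Sum>p\<in>A \<inter> {..N}. 1 / real p)) \<longlonglongrightarrow> euler_correction A"
proof -
  interpret mertens_weight "\<lambda>n. 1 / real n" by (rule recip_weight)
  let ?d = "\<lambda>p. if p \<in> A then - ln (1 - 1 / real p) - 1 / real p else 0"
  have E0: "euler_factor p 0 = 1 / (1 - 1 / real p)" if "prime p" for p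
    using sums_unique[OF prime_powers[OF that]] prime_gt_0_nat[OF that] by (simp add: euler_factor_def)
  have pr: "prime p" if "p \<in> A" for p using that assms by auto
  have p2: "real p \<ge> 2" if "p \<in> A" for p using prime_ge_2_nat[OF pr[OF that]] by simp
  \<comment> \<open>These are the terms of \<open>log_correction\<close> at s = 0, whose summability
    is already known.\<close>
  have "?d = (\<lambda>p. if p \<in> A then ln (euler_factor p 0) - real p powr (- 1 - 0) else 0)"
  proof
    fix p show "?d p = (if p \<in> A then ln (euler_factor p 0) - real p powr (- 1 - 0) else 0)"
      using p2[of p] E0[OF pr, of p] by (simp add: ln_div powr_minus_divide)
  qed
  then have "summable ?d" using summable_log_correction[OF assms, of 0] by simp
  then have "(\<lambda>N. \<Sum>p\<le>N. ?d p) \<longlonglongrightarrow> euler_correction A"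
    unfolding euler_correction_def by (rule summable_LIMSEQ')
  moreover have "(\<Sum>p\<le>N. ?d p) = ln (infsum (\<lambda>n. 1 / real n) (smooth (A \<inter> {..N}))) - (\<Sum>p\<in>A \<inter> {..N}. 1 / real p)" for N
  proof -
    have "(\<Sum>p\<le>N. ?d p) = (\<Sum>p\<in>A \<inter> {..N}. - ln (1 - 1 / real p) - 1 / real p)"
      by (subst sum.inter_restrict[symmetric]) (auto simp: Int_commute intro: sum.cong)
    also have "\<dots> = (\<Sum>p\<in>A \<inter> {..N}. ln (1 / (1 - 1 / real p))) - (\<Sum>p\<in>A \<inter> {..N}. 1 / real p)"
      unfolding sum_subtractf using p2 by (intro arg_cong2[of _ _ _ _ "(-)"] sum.cong refl) (force simp: ln_div)
    also have "(\<Sum>p\<in>A \<inter> {..N}. ln (1 / (1 - 1 / real p))) = ln (\<Prod>p\<in>A \<inter> {..N}. 1 / (1 - 1 / real p))"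
      using p2 by (subst ln_prod) (force simp: field_simps)+
    also have "(\<Prod>p\<in>A \<inter> {..N}. 1 / (1 - 1 / real p)) = infsum (\<lambda>n. 1 / real n) (smooth (A \<inter> {..N}))"
      using assms by (intro infsum_smooth_recip[symmetric]) auto
    finally show ?thesis .
  qed
  ultimately show ?thesis by simp
qed

section \<open>Primes and sets of primes of positive density\<close>

definition zeta_sum :: "real \<Rightarrow> real" where
  "zeta_sum s = (\<Sum>n. real n powr (- 1 - s))"

text \<open>Replaces comparison with the integral of x^(-1-s). With t = s ln ((x + 1) / x), which
  lies between s / (x + 1) and s / x, both bounds are instances of 1 + u <= e^u.\<close>

lemma powr_difference_bounds:
  fixes x s :: real
  assumes "x > 0" "s > 0"
  shows "s * (x + 1) powr (- 1 - s) \<le> x powr (- s) - (x + 1) powr (- s)"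
    and "x powr (- s) - (x + 1) powr (- s) \<le> s * x powr (- 1 - s)"
proof -
  define t where "t = s * ln ((x + 1) / x)"
  have x1: "x powr (- s) = (x + 1) powr (- s) * exp t"
    using assms by (simp add: t_def powr_def ln_div algebra_simps flip: exp_add)
  have x2: "(x + 1) powr (- s) = x powr (- s) * exp (- t)"
    unfolding x1 by (simp flip: exp_add)
  have "ln ((x + 1) / x) \<le> (x + 1) / x - 1" using assms by (intro ln_le_minus_one) auto
  then have "ln ((x + 1) / x) \<le> 1 / x" using assms by (simp add: field_simps)
  then have t_le: "t \<le> s / x" using mult_left_mono[of _ "1 / x" s] assms by (simp add: t_def)
  have "ln (x / (x + 1)) \<le> x / (x + 1) - 1" using assms by (intro ln_le_minus_one) auto
  then have "1 / (x + 1) \<le> ln ((x + 1) / x)" using assms by (simp add: field_simps ln_div)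
  then have t_ge: "s / (x + 1) \<le> t" using mult_left_mono[of "1 / (x + 1)" _ s] assms by (simp add: t_def)
  have "s * (x + 1) powr (- 1 - s) = (x + 1) powr (- s) * (s / (x + 1))"
    using assms by (simp add: powr_diff powr_minus field_simps)
  also have "\<dots> \<le> (x + 1) powr (- s) * (exp t - 1)"
    using t_ge exp_ge_add_one_self[of t] by (intro mult_left_mono) (linarith | simp)+
  finally show "s * (x + 1) powr (- 1 - s) \<le> x powr (- s) - (x + 1) powr (- s)"
    unfolding x1 by (simp add: algebra_simps)
  have "x powr (- s) * (1 - exp (- t)) \<le> x powr (- s) * (s / x)"
    using t_le exp_ge_add_one_self[of "- t"] by (intro mult_left_mono) (linarith | simp)+
  also have "\<dots> = s * x powr (- 1 - s)"
    using assms by (simp add: powr_diff powr_minus field_simps)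
  finally show "x powr (- s) - (x + 1) powr (- s) \<le> s * x powr (- 1 - s)"
    unfolding x2 by (simp add: algebra_simps)
qed

lemma summable_zeta_sum: "s > 0 \<Longrightarrow> summable (\<lambda>n. real n powr (- 1 - s))"
  by (subst summable_real_powr_iff) auto

text \<open>Summing the difference bounds over x = 1, 2, ... telescopes to 1.\<close>

lemma zeta_sum_bounds:
  assumes "s > 0"
  shows "1 \<le> s * zeta_sum s" "s * zeta_sum s \<le> 1 + s"
proof -
  have "(\<lambda>n. real (Suc n) powr (- s)) \<longlonglongrightarrow> 0"
    using assms by real_asymp
  from telescope_sums'[OF this] have tel: "(\<lambda>n. real (Suc n) powr (- s) - real (Suc (Suc n)) powr (- s)) sums 1"
    by simp
  have z: "(\<lambda>n. real n powr (- 1 - s)) sums zeta_sum s"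
    unfolding zeta_sum_def using summable_zeta_sum[OF assms] by (rule summable_sums)
  \<comment> \<open>The term dropped here is n = 0, where \<open>powr\<close> is 0; the next shift
    drops n = 1, worth 1.\<close>
  have z1: "(\<lambda>n. real (Suc n) powr (- 1 - s)) sums zeta_sum s"
    using z by (subst sums_Suc_iff) simp
  have z2: "(\<lambda>n. real (Suc (Suc n)) powr (- 1 - s)) sums (zeta_sum s - 1)"
    using z1 by (subst sums_Suc_iff) simp
  show "1 \<le> s * zeta_sum s"
    by (rule sums_le[OF _ tel sums_mult[OF z1]])
       (use powr_difference_bounds(2)[of "real (Suc _)" s] assms in \<open>simp add: add.commute\<close>)
  have "s * (zeta_sum s - 1) \<le> 1"
    by (rule sums_le[OF _ sums_mult[OF z2] tel])
       (use powr_difference_bounds(1)[of "real (Suc _)" s] assms in \<open>simp add: add.commute\<close>)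
  then show "s * zeta_sum s \<le> 1 + s" by (simp add: algebra_simps)
qed

text \<open>Every positive integer is smooth over all primes, so the Euler product for 1/n is zeta
  at 1 + s; its logarithm is \<open>prime_series\<close> plus a convergent correction.\<close>

lemma prime_series_all_asymp:
  "((\<lambda>s. prime_series {p. prime p} s + ln s) \<longlongrightarrow> - euler_correction {p. prime p}) (at_right 0)"
proof -
  interpret mertens_weight "\<lambda>n. 1 / real n" by (rule recip_weight)
  let ?P = "{p::nat. prime p}"
  have "((\<lambda>s::real. s * zeta_sum s) \<longlongrightarrow> 1) (at_right 0)"
  proof (rule tendsto_sandwich)
    show "\<forall>\<^sub>F s in at_right 0. 1 \<le> s * zeta_sum s" "\<forall>\<^sub>F s in at_right 0. s * zeta_sum s \<le> 1 + s"
      using eventually_at_right_less[of "0::real"] by (auto elim!: eventually_mono simp: zeta_sum_bounds)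
    show "((\<lambda>s::real. 1 + s) \<longlongrightarrow> 1) (at_right 0)" by (auto intro!: tendsto_eq_intros)
  qed auto
  then have "((\<lambda>s. ln (s * zeta_sum s) - log_correction ?P s) \<longlongrightarrow> ln 1 - euler_correction ?P) (at_right 0)"
    by (intro tendsto_intros log_correction_tendsto) auto
  then show ?thesis
  proof (rule Lim_transform_eventually[OF tendsto_eq_rhs])
    show "\<forall>\<^sub>F s in at_right 0. ln (s * zeta_sum s) - log_correction ?P s = prime_series ?P s + ln s"
      using eventually_at_right_less[of "0::real"]
    proof eventually_elim
      case (elim s)
      have "(if n \<in> smooth ?P then 1 / real n * real n powr (- s) else 0) = real n powr (- 1 - s)" for n
        by (cases "n = 0") (auto simp: smooth_def powr_diff powr_minus field_simps)
      then have Z: "zeta_sum s = exp (prime_series ?P s + log_correction ?P s)"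
        using sums_unique[OF dirichlet_series_sums[OF subset_refl elim]] by (simp add: zeta_sum_def)
      show ?case unfolding Z using elim by (simp add: ln_mult)
    qed
  qed simp
qed

text \<open>Minus the derivative of \<open>prime_series A\<close> in s.\<close>

definition prime_log_series :: "nat set \<Rightarrow> real \<Rightarrow> real" where
  "prime_log_series A s = (\<Sum>p. if p \<in> A then ln (real p) * real p powr (- 1 - s) else 0)"

lemma summable_prime_log_series:
  assumes "s > 0"
  shows "summable (\<lambda>p. if p \<in> A then ln (real p) * real p powr (- 1 - s) else 0)"
proof (rule summable_comparison_test')
  show "summable (\<lambda>p. 2 / s * real p powr (- 1 - s / 2))"
    using assms by (intro summable_mult summable_zeta_sum) auto
  fix p :: nat
  show "norm (if p \<in> A then ln (real p) * real p powr (- 1 - s) else 0) \<le> 2 / s * real p powr (- 1 - s / 2)"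
  proof (cases "p = 0")
    case False
    \<comment> \<open>Half of the exponent s is spent on the logarithm; the other half keeps the
      series convergent.\<close>
    have "ln (real p) \<le> real p powr (s / 2) / (s / 2)"
      using False assms by (intro ln_powr_bound) auto
    then have "ln (real p) * real p powr (- 1 - s) \<le> real p powr (s / 2) / (s / 2) * real p powr (- 1 - s)"
      by (intro mult_right_mono) auto
    also have "\<dots> = 2 / s * (real p powr (s / 2) * real p powr (- 1 - s))" by simp
    also have "real p powr (s / 2) * real p powr (- 1 - s) = real p powr (- 1 - s / 2)"
      unfolding powr_add[symmetric] by (rule arg_cong2[of _ _ _ _ "(powr)"]) auto
    finally show ?thesis using False assms by (auto simp: abs_mult)
  qed simp
qed

text \<open>\<open>prime_series A\<close> is convex in s, and this says that its tangent at s lies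
  below the graph at c s. Termwise it is 1 - e^(-t) <= t. Convexity is what permits an asymptotic
  relation to be differentiated.\<close>

lemma prime_series_difference_le:
  assumes "s > 0" "c > 0"
  shows "prime_series A s - prime_series A (c * s) \<le> (c - 1) * (s * prime_log_series A s)"
proof -
  have cs: "c * s > 0" using assms by simp
  have "prime_series A s - prime_series A (c * s) \<le> ((c - 1) * s) * prime_log_series A s"
    unfolding prime_series_def prime_log_series_def
  proof (rule sums_le[OF _ sums_diff[OF summable_sums summable_sums] sums_mult[OF summable_sums]])
    fix p :: nat
    show "(if p \<in> A then real p powr (- 1 - s) else 0) - (if p \<in> A then real p powr (- 1 - c * s) else 0)
      \<le> (c - 1) * s * (if p \<in> A then ln (real p) * real p powr (- 1 - s) else 0)"
    proof (cases "p = 0")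
      case False
      define t where "t = (c - 1) * s * ln (real p)"
      have "real p powr (- 1 - c * s) = real p powr (- 1 - s) * exp (- t)"
        using False by (simp add: t_def powr_def algebra_simps flip: exp_add)
      moreover have "real p powr (- 1 - s) * (1 - exp (- t)) \<le> real p powr (- 1 - s) * t"
        using exp_ge_add_one_self[of "- t"] by (intro mult_left_mono) auto
      ultimately show ?thesis by (simp add: t_def algebra_simps)
    qed simp
  qed (use assms cs in \<open>auto intro: summable_prime_series summable_prime_log_series\<close>)
  then show ?thesis by (simp add: mult.assoc)
qed

lemma filterlim_cmult_at_right_0:
  "c > 0 \<Longrightarrow> filterlim (\<lambda>s. c * s) (at_right 0) (at_right (0::real))"
  by (rule filterlim_times_pos[OF filterlim_ident]) auto

lemma prime_log_series_all_asymp: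
  "((\<lambda>s. s * prime_log_series {p. prime p} s) \<longlongrightarrow> 1) (at_right 0)"
proof -
  let ?P = "{p::nat. prime p}"
  have H: "((\<lambda>s. prime_series ?P s - prime_series ?P (c * s)) \<longlongrightarrow> ln c) (at_right 0)" if c: "c > 0" for c :: real
  proof -
    from filterlim_compose[OF prime_series_all_asymp filterlim_cmult_at_right_0[OF c]]
    have "((\<lambda>s. (prime_series ?P s + ln s) - (prime_series ?P (c * s) + ln (c * s)) + ln c)
        \<longlongrightarrow> - euler_correction ?P - - euler_correction ?P + ln c) (at_right 0)"
      by (intro tendsto_intros prime_series_all_asymp)
    then show ?thesis
    proof (rule Lim_transform_eventually[OF tendsto_eq_rhs])
      show "\<forall>\<^sub>F s in at_right 0. (prime_series ?P s + ln s) - (prime_series ?P (c * s) + ln (c * s)) + ln c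
          = prime_series ?P s - prime_series ?P (c * s)"
        using eventually_at_right_less[of "0::real"] by eventually_elim (use c in \<open>simp add: ln_mult\<close>)
    qed simp
  qed
  \<comment> \<open>\<open>prime_series_difference_le\<close> bounds the limit below by \<open>ln c / (c - 1)\<close> for \<open>c > 1\<close> and above
    by it for \<open>c < 1\<close>; let \<open>c\<close> tend to 1.\<close>
  show ?thesis
  proof (rule order_tendstoI)
    fix a :: real assume "a < 1"
    moreover have "((\<lambda>c::real. ln c / (c - 1)) \<longlongrightarrow> 1) (at_right 1)" by real_asymp
    ultimately have "\<forall>\<^sub>F c in at_right 1. a < ln c / (c - 1) \<and> c > 1"
      using eventually_at_right_less by (intro eventually_conj) (auto dest: order_tendstoD(1))
    then obtain c where c: "a < ln c / (c - 1)" "c > 1"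
      using eventually_happens'[OF trivial_limit_at_right_real] by blast
    then have "(c - 1) * a < ln c" by (simp add: field_simps)
    then have "\<forall>\<^sub>F s in at_right 0. (c - 1) * a < prime_series ?P s - prime_series ?P (c * s)"
      using H[of c] c by (auto dest: order_tendstoD(1))
    then show "\<forall>\<^sub>F s in at_right 0. a < s * prime_log_series ?P s"
      using eventually_at_right_less[of "0::real"]
    proof eventually_elim
      case (elim s)
      then have "(c - 1) * a < (c - 1) * (s * prime_log_series ?P s)"
        using prime_series_difference_le[of s c ?P] c by linarith
      then show ?case using c by simp
    qed
  next
    fix a :: real assume "a > 1"
    moreover have "((\<lambda>c::real. ln c / (c - 1)) \<longlongrightarrow> 1) (at_left 1)" by real_asymp
    ultimately have "\<forall>\<^sub>F c in at_left 1. ln c / (c - 1) < a \<and> c \<in> {0<..<1}"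
      using eventually_at_left_real[of 0 1] by (intro eventually_conj) (auto dest: order_tendstoD(2))
    then obtain c where c: "ln c / (c - 1) < a" "0 < c" "c < 1"
      using eventually_happens'[OF trivial_limit_at_left_real, of _ "1::real"] by auto
    then have "(c - 1) * a < ln c" by (simp add: field_simps)
    then have "\<forall>\<^sub>F s in at_right 0. (c - 1) * a < prime_series ?P s - prime_series ?P (c * s)"
      using H[of c] c by (auto dest: order_tendstoD(1))
    then show "\<forall>\<^sub>F s in at_right 0. s * prime_log_series ?P s < a"
      using eventually_at_right_less[of "0::real"]
    proof eventually_elim
      case (elim s)
      then have "(c - 1) * a < (c - 1) * (s * prime_log_series ?P s)"
        using prime_series_difference_le[of s c ?P] c by linarith
      then show ?case using c by simp
    qed
  qed
qed

section \<open>Abel summation: from counting primes to logarithmic series\<close>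

lemma abel_lower_bound:
  fixes x f :: "nat \<Rightarrow> real"
  assumes "\<And>n. f (Suc n) \<le> f n" "\<And>n. f n \<ge> 0" "\<And>n. - C \<le> (\<Sum>i<n. x i)"
  shows "- C * f 0 \<le> (\<Sum>i<n. x i * f i)"
proof -
  \<comment> \<open>The induction carries the boundary term of summation by parts.\<close>
  have "- C * (f 0 - f n) + (\<Sum>i<n. x i) * f n \<le> (\<Sum>i<n. x i * f i)"
  proof (induction n)
    case (Suc n)
    have "- C * (f n - f (Suc n)) \<le> (\<Sum>i<Suc n. x i) * (f n - f (Suc n))"
      using assms(1)[of n] assms(3)[of "Suc n"] by (intro mult_right_mono) linarith+
    then show ?case using Suc by (simp add: algebra_simps)
  qed simp
  moreover have "- C * f n \<le> (\<Sum>i<n. x i) * f n"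
    using assms by (intro mult_right_mono) auto
  ultimately show ?thesis by (simp add: algebra_simps)
qed

text \<open>K does not depend on s, so it is lost when the series is multiplied by s and s tends to
  0. Finitely many negative partial sums only affect K.\<close>

lemma log_series_lower_bound:
  fixes x :: "nat \<Rightarrow> real"
  assumes "\<forall>\<^sub>F N in sequentially. 0 \<le> (\<Sum>n<N. x n)"
  obtains K where "\<And>s S. s > 0 \<Longrightarrow> (\<lambda>n. x n * (ln (real n) * real n powr (- 1 - s))) sums S \<Longrightarrow> - K \<le> S"
proof -
  let ?X = "\<lambda>N. \<Sum>n<N. x n"
  obtain M where M: "\<And>N. N \<ge> M \<Longrightarrow> 0 \<le> ?X N"
    using assms unfolding eventually_sequentially by blast
  define B where "B = (\<Sum>N<M. \<bar>?X N\<bar>)"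
  have B: "- B \<le> ?X N" for N
  proof (cases "N < M")
    case True
    then have "\<bar>?X N\<bar> \<le> B" unfolding B_def by (intro member_le_sum) auto
    then show ?thesis by linarith
  next
    case False
    have "B \<ge> 0" unfolding B_def by (intro sum_nonneg) auto
    then show ?thesis using M[of N] False by linarith
  qed
  define C where "C = B + \<bar>?X 3\<bar>"
  have C0: "C \<ge> 0" unfolding C_def B_def by (intro add_nonneg_nonneg sum_nonneg) auto
  have C: "- C \<le> (\<Sum>i<n. x (i + 3))" for n
  proof -
    have "?X (n + 3) = ?X 3 + (\<Sum>i<n. x (i + 3))"
      using sum.atLeastLessThan_concat[of 0 3 "n + 3" x] sum.shift_bounds_nat_ivl[of x 0 3 n]
      by (simp add: lessThan_atLeast0)
    then show ?thesis using B[of "n + 3"] unfolding C_def by linarith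
  qed
  \<comment> \<open>\<open>ln x / x\<close> decreases only from \<open>x = exp 1\<close> on, so Abel summation starts at 3.\<close>
  show ?thesis
  proof (rule that[of "C + \<bar>x 2\<bar>"])
    fix s S :: real assume s: "s > 0" and S: "(\<lambda>n. x n * (ln (real n) * real n powr (- 1 - s))) sums S"
    define f where "f i = ln (real (i + 3)) * real (i + 3) powr (- 1 - s)" for i
    have f_eq: "f i = ln (real (i + 3)) / real (i + 3) * real (i + 3) powr (- s)" for i
      by (simp add: f_def powr_diff powr_minus field_simps)
    have e3: "exp 1 \<le> (3::real)" by (rule exp_le)
    have mono: "ln (real (Suc i + 3)) / real (Suc i + 3) \<le> ln (real (i + 3)) / real (i + 3)" for i
      using e3 by (intro ln_x_over_x_mono) auto
    have "f (Suc i) \<le> f i" for i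
      unfolding f_eq using s mono[of i] by (intro mult_mono powr_mono2') auto
    moreover have "f i \<ge> 0" for i by (simp add: f_def)
    ultimately have ge: "- C * f 0 \<le> (\<Sum>i<n. x (i + 3) * f i)" for n
      using C by (rule abel_lower_bound)
    \<comment> \<open>Of the three removed terms, n = 0 and n = 1 are zero, so only n = 2
      remains.\<close>
    have tail: "(\<lambda>i. x (i + 3) * f i) sums (S - x 2 * (ln 2 * 2 powr (- 1 - s)))"
      using S unfolding f_def by (subst sums_iff_shift) (simp add: numeral_3_eq_3 lessThan_Suc numeral_2_eq_2)
    have "- C * f 0 \<le> S - x 2 * (ln 2 * 2 powr (- 1 - s))"
      using ge tail unfolding sums_def by (intro LIMSEQ_le_const) auto
    moreover have "f 0 \<le> 1"
    proof -
      have "ln (3::real) \<le> 3" using ln_le_minus_one[of "3::real"] by simp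
      then have "ln 3 / 3 * 3 powr (- s) \<le> (1 * 1 :: real)"
        using s by (intro mult_mono) (auto simp: powr_minus_divide ge_one_powr_ge_zero)
      then show ?thesis by (simp add: f_eq)
    qed
    then have "C * f 0 \<le> C" using C0 by (intro mult_left_le) auto
    moreover have "\<bar>x 2 * (ln 2 * 2 powr (- 1 - s))\<bar> \<le> \<bar>x 2\<bar>"
    proof -
      have "2 powr (- 1 - s) \<le> 2 powr (0::real)" using s by (intro powr_mono) auto
      then have "ln 2 * 2 powr (- 1 - s) \<le> 1 * (1::real)"
        using ln_le_minus_one[of "2::real"] by (intro mult_mono) auto
      then show ?thesis unfolding abs_mult by (intro mult_left_le) (auto simp: abs_mult)
    qed
    ultimately show "- (C + \<bar>x 2\<bar>) \<le> S" by linarith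
  qed
qed

text \<open>For \<tau> < \<theta> the counting function of A eventually exceeds \<tau> times that of
  all primes; for \<tau> > \<theta> it is the reverse. Abel summation carries each one-sided
  inequality over to the series with bounded loss. Counts are compared only with each other, so the
  size of the prime counting function never matters.\<close>

lemma prime_density_log_series_asymp:
  assumes A: "A \<subseteq> {p. prime p}" and dens: "has_prime_density A \<theta>"
  shows "((\<lambda>s. s * prime_log_series A s) \<longlongrightarrow> \<theta>) (at_right 0)"
proof -
  let ?P = "{p::nat. prime p}"
  let ?x = "\<lambda>\<tau> n. of_bool (n \<in> A) - \<tau> * of_bool (n \<in> ?P)"
  have count: "(\<Sum>n<Suc N. of_bool (n \<in> B)) = real (card (B \<inter> {1..N}))" if "B \<subseteq> ?P" for B N
  proof -
    have "(\<Sum>n<Suc N. of_bool (n \<in> B)) = real (card {n \<in> {..<Suc N}. n \<in> B})"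
      by (subst sum_of_bool_eq) (auto simp: Int_def)
    also have "{n \<in> {..<Suc N}. n \<in> B} = B \<inter> {1..N}"
      using that by (auto simp: less_Suc_eq_le Suc_le_eq prime_gt_0_nat)
    finally show ?thesis .
  qed
  have part: "(\<Sum>n<Suc N. ?x \<tau> n) = real (card (A \<inter> {1..N})) - \<tau> * real (card (?P \<inter> {1..N}))" for \<tau> N
    unfolding sum_subtractf sum_distrib_left[symmetric] count[OF A] count[OF subset_refl] ..
  have pos: "\<forall>\<^sub>F N in sequentially. 0 < real (card (?P \<inter> {1..N}))"
    using eventually_ge_at_top[of 2]
  proof eventually_elim
    case (elim N)
    then have "2 \<in> ?P \<inter> {1..N}" by (auto simp: two_is_prime_nat)
    then have "?P \<inter> {1..N} \<noteq> {}" by blast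
    then show ?case by (simp only: of_nat_0_less_iff card_gt_0_iff) simp
  qed
  have series: "(\<lambda>n. ?x \<tau> n * (ln (real n) * real n powr (- 1 - s))) sums (prime_log_series A s - \<tau> * prime_log_series ?P s)"
    if "s > 0" for \<tau> s
  proof -
    have "(\<lambda>n. (if n \<in> A then ln (real n) * real n powr (- 1 - s) else 0) - \<tau> * (if n \<in> ?P then ln (real n) * real n powr (- 1 - s) else 0))
       sums (prime_log_series A s - \<tau> * prime_log_series ?P s)"
      unfolding prime_log_series_def using that
      by (intro sums_diff sums_mult summable_sums summable_prime_log_series)
    then show ?thesis by (rule sums_cong[THEN iffD1, rotated]) (auto simp: algebra_simps)
  qed
  have lim0: "((\<lambda>s. \<tau> * (s * prime_log_series ?P s) + K * s) \<longlongrightarrow> \<tau>) (at_right 0)" for \<tau> K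
    using tendsto_add[OF tendsto_mult[OF tendsto_const[of \<tau>] prime_log_series_all_asymp] tendsto_mult[OF tendsto_const[of K] tendsto_ident_at]]
    by simp
  note dens' = dens[unfolded has_prime_density_def]
  show ?thesis
  proof (rule order_tendstoI)
    fix a assume "a < \<theta>"
    then obtain \<tau> where \<tau>: "a < \<tau>" "\<tau> < \<theta>" using dense by blast
    have "\<forall>\<^sub>F N in sequentially. 0 \<le> (\<Sum>n<Suc N. ?x \<tau> n)"
      using order_tendstoD(1)[OF dens' \<tau>(2)] pos
    proof eventually_elim
      case (elim N)
      then show ?case unfolding part by (simp add: pos_less_divide_eq)
    qed
    then have "\<forall>\<^sub>F N in sequentially. 0 \<le> (\<Sum>n<N. ?x \<tau> n)"
      using eventually_sequentially_Suc by blast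
    from log_series_lower_bound[of "?x \<tau>", OF this] obtain K where K: "\<And>s S. s > 0 \<Longrightarrow> (\<lambda>n. ?x \<tau> n * (ln (real n) * real n powr (- 1 - s))) sums S \<Longrightarrow> - K \<le> S"
      by blast
    have "\<forall>\<^sub>F s in at_right 0. a < \<tau> * (s * prime_log_series ?P s) + (- K) * s"
      using order_tendstoD(1)[OF lim0 \<tau>(1)] by blast
    then show "\<forall>\<^sub>F s in at_right 0. a < s * prime_log_series A s"
      using eventually_at_right_less[of "0::real"]
    proof eventually_elim
      case (elim s)
      have "s * (- K) \<le> s * (prime_log_series A s - \<tau> * prime_log_series ?P s)"
        using K[OF elim(2) series[OF elim(2)]] elim by (intro mult_left_mono) auto
      then show ?case using elim by (simp add: algebra_simps)
    qed
  next
    fix a assume "a > \<theta>"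
    then obtain \<tau> where \<tau>: "\<theta> < \<tau>" "\<tau> < a" using dense by blast
    have "\<forall>\<^sub>F N in sequentially. 0 \<le> (\<Sum>n<Suc N. - ?x \<tau> n)"
      using order_tendstoD(2)[OF dens' \<tau>(1)] pos
    proof eventually_elim
      case (elim N)
      then show ?case unfolding sum_negf part by (simp add: pos_divide_less_eq)
    qed
    then have "\<forall>\<^sub>F N in sequentially. 0 \<le> (\<Sum>n<N. - ?x \<tau> n)"
      using eventually_sequentially_Suc by blast
    from log_series_lower_bound[of "\<lambda>n. - ?x \<tau> n", OF this] obtain K where K: "\<And>s S. s > 0 \<Longrightarrow> (\<lambda>n. - ?x \<tau> n * (ln (real n) * real n powr (- 1 - s))) sums S \<Longrightarrow> - K \<le> S"
      by blast
    have "\<forall>\<^sub>F s in at_right 0. \<tau> * (s * prime_log_series ?P s) + K * s < a"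
      using order_tendstoD(2)[OF lim0 \<tau>(2)] by blast
    then show "\<forall>\<^sub>F s in at_right 0. s * prime_log_series A s < a"
      using eventually_at_right_less[of "0::real"]
    proof eventually_elim
      case (elim s)
      have "(\<lambda>n. - ?x \<tau> n * (ln (real n) * real n powr (- 1 - s))) sums - (prime_log_series A s - \<tau> * prime_log_series ?P s)"
        using sums_minus[OF series[OF elim(2), of \<tau>]] by (simp only: mult_minus_left)
      from K[OF elim(2) this] have "s * (- K) \<le> s * (- (prime_log_series A s - \<tau> * prime_log_series ?P s))"
        using elim by (intro mult_left_mono) auto
      then show ?case using elim by (simp add: algebra_simps)
    qed
  qed
qed

section \<open>The primes of A as a Laplace family\<close>

lemma exp_ln_powr: "n > 0 \<Longrightarrow> exp (- (s * ln (real n))) = real n powr (- s)"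
  by (simp add: powr_def)

text \<open>The factor ln p cancels the 1/t of the test functions at t = s ln p, so that means of
  \<open>frullani_test\<close> and \<open>euler_test\<close> become sums of p^(-1-s) and
  1/p.\<close>

definition prime_log_weight :: "nat set \<Rightarrow> nat \<Rightarrow> real" where
  "prime_log_weight A p = (if p \<in> A then ln (real p) / real p else 0)"

locale prime_density =
  fixes A :: "nat set" and \<theta> :: real
  assumes primes: "A \<subseteq> {p. prime p}" and theta_pos: "\<theta> > 0"
    and density: "has_prime_density A \<theta>"
begin

lemma prime_A: "p \<in> A \<Longrightarrow> prime p"
  using primes by auto

lemma A_ge_2: "p \<in> A \<Longrightarrow> real p \<ge> 2"
  using prime_ge_2_nat[OF prime_A] by simp

lemma ln_A_pos: "p \<in> A \<Longrightarrow> ln (real p) > 0"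
  using A_ge_2[of p] by simp

lemma log_series_asymp: "((\<lambda>s. s * prime_log_series A s) \<longlongrightarrow> \<theta>) (at_right 0)"
  using primes density by (rule prime_density_log_series_asymp)

lemma prime_log_term:
  "prime_log_weight A p * exp (- (s * ln (real p))) = (if p \<in> A then ln (real p) * real p powr (- 1 - s) else 0)"
  using A_ge_2[of p] by (simp add: prime_log_weight_def exp_ln_powr powr_diff powr_minus divide_simps)

lemma laplace_sum_prime_log: "laplace_sum (prime_log_weight A) (\<lambda>p. ln (real p)) (\<lambda>_. 1) s = prime_log_series A s"
  unfolding laplace_sum_def prime_log_series_def mult_1_right prime_log_term ..

lemma A_nonempty: "A \<noteq> {}"
proof
  assume "A = {}"
  then have "(\<lambda>N::nat. 0) \<longlonglongrightarrow> \<theta>" using density by (simp add: has_prime_density_def)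
  then show False using theta_pos LIMSEQ_unique[OF tendsto_const] by fastforce
qed

lemma prime_log_series_pos:
  assumes "s > 0"
  shows "prime_log_series A s > 0"
proof -
  obtain p where p: "p \<in> A" using A_nonempty by blast
  show ?thesis
    unfolding prime_log_series_def
    by (rule suminf_pos2[OF summable_prime_log_series[OF assms], of _ p])
       (use p ln_A_pos A_ge_2[OF p] in \<open>auto simp: less_imp_le\<close>)
qed

text \<open>The index is 1 whatever \<theta> is, since s times the transform has a limit; that the
  limit \<theta> is nonzero is what allows the quotient to be taken.\<close>

lemma prime_log_family: "laplace_family (prime_log_weight A) (\<lambda>p. ln (real p)) 1"
proof
  show "0 \<le> prime_log_weight A n" for n
    using ln_A_pos[of n] by (simp add: prime_log_weight_def less_imp_le)
  show "0 \<le> ln (real n)" for n by (cases "n = 0") auto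
  show "summable (\<lambda>n. prime_log_weight A n * exp (- (s * ln (real n))))" if "s > 0" for s
    unfolding prime_log_term using that by (rule summable_prime_log_series)
  show "laplace_sum (prime_log_weight A) (\<lambda>p. ln (real p)) (\<lambda>_. 1) s > 0" if "s > 0" for s
    unfolding laplace_sum_prime_log using that by (rule prime_log_series_pos)
  fix j :: nat assume j: "j \<ge> 1"
  have "((\<lambda>s. (real j * s * prime_log_series A (real j * s)) / (s * prime_log_series A s) / real j) \<longlongrightarrow> \<theta> / \<theta> / real j) (at_right 0)"
    using theta_pos j
    by (intro tendsto_divide filterlim_compose[OF log_series_asymp filterlim_cmult_at_right_0] log_series_asymp tendsto_const) auto
  then show "((\<lambda>s. laplace_sum (prime_log_weight A) (\<lambda>p. ln (real p)) (\<lambda>_. 1) (real j * s) /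
       laplace_sum (prime_log_weight A) (\<lambda>p. ln (real p)) (\<lambda>_. 1) s) \<longlongrightarrow> real j powr - 1) (at_right 0)"
    unfolding laplace_sum_prime_log
  proof (rule Lim_transform_eventually[OF tendsto_eq_rhs])
    show "\<theta> / \<theta> / real j = real j powr - 1" using theta_pos j by (simp add: powr_minus_divide)
    show "\<forall>\<^sub>F s in at_right 0. (real j * s * prime_log_series A (real j * s)) / (s * prime_log_series A s) / real j
        = prime_log_series A (real j * s) / prime_log_series A s"
      using eventually_at_right_less[of "0::real"] by eventually_elim (use j in simp)
  qed
qed

text \<open>The difference is exactly s times the unnormalised Frullani sum; the total mass times s
  supplies the factor \<theta>.\<close>

lemma prime_series_ratio:
  assumes j: "j \<ge> 1"
  shows "((\<lambda>s. prime_series A (real j * s) - prime_series A s) \<longlongrightarrow> - \<theta> * ln (real j)) (at_right 0)"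
proof -
  let ?M = "laplace_mean (prime_log_weight A) (\<lambda>p. ln (real p)) (frullani_test j)"
  have "((\<lambda>s. ?M s * (s * prime_log_series A s)) \<longlongrightarrow> - ln (real j) * \<theta>) (at_right 0)"
    by (intro tendsto_mult frullani_mean prime_log_family j log_series_asymp)
  then show ?thesis
  proof (rule Lim_transform_eventually[OF tendsto_eq_rhs])
    show "\<forall>\<^sub>F s in at_right 0. ?M s * (s * prime_log_series A s) = prime_series A (real j * s) - prime_series A s"
      using eventually_at_right_less[of "0::real"]
    proof eventually_elim
      case (elim s)
      have js: "real j * s > 0" using elim j by simp
      have "(\<lambda>p. ((if p \<in> A then real p powr (- 1 - real j * s) else 0) - (if p \<in> A then real p powr (- 1 - s) else 0)) / s)
        sums ((prime_series A (real j * s) - prime_series A s) / s)"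
        unfolding prime_series_def using elim js
        by (intro sums_divide sums_diff summable_sums summable_prime_series)
      moreover have "((if p \<in> A then real p powr (- 1 - real j * s) else 0) - (if p \<in> A then real p powr (- 1 - s) else 0)) / s
        = prime_log_weight A p * exp (- (s * ln (real p))) * frullani_test j (exp (- (s * ln (real p))))" for p
      proof (cases "p \<in> A")
        case True
        then have p: "real p \<ge> 2" "ln (real p) > 0" using A_ge_2 ln_A_pos by blast+
        have "exp (- (s * ln (real p))) * frullani_test j (exp (- (s * ln (real p))))
            = (exp (- (real j * (s * ln (real p)))) - exp (- (s * ln (real p)))) / (s * ln (real p))"
          using p elim j by (intro frullani_test_exp) auto
        also have "exp (- (real j * (s * ln (real p)))) = real p powr (- real j * s)"
          using p by (simp add: powr_def)
        also have e: "exp (- (s * ln (real p))) = real p powr (- s)"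
          using p by (simp add: powr_def)
        finally have *: "real p powr (- s) * frullani_test j (real p powr (- s))
            = (real p powr (- real j * s) - real p powr (- s)) / (s * ln (real p))" .
        show ?thesis unfolding mult.assoc e * using True p elim
          by (simp add: prime_log_weight_def powr_diff powr_minus divide_simps)
      qed (simp add: prime_log_weight_def)
      ultimately have "laplace_sum (prime_log_weight A) (\<lambda>p. ln (real p)) (frullani_test j) s
          = (prime_series A (real j * s) - prime_series A s) / s"
        unfolding laplace_sum_def by (simp add: sums_iff)
      then show ?case
        using elim prime_log_series_pos[OF elim] by (simp add: laplace_mean_def laplace_sum_prime_log)
    qed
  qed simp
qed

text \<open>The source of e^(\<gamma>\<theta>): the cost of cutting the prime sum sharply at
  e^(1/s), read off from \<open>euler_test\<close>.\<close>

lemma prime_series_cutoff: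
  "((\<lambda>s. prime_series A s - (\<Sum>p\<in>{p\<in>A. s * ln (real p) \<le> 1}. 1 / real p)) \<longlongrightarrow> - euler_mascheroni * \<theta>) (at_right 0)"
proof -
  let ?M = "laplace_mean (prime_log_weight A) (\<lambda>p. ln (real p)) euler_test"
  have "((\<lambda>s. ?M s * (s * prime_log_series A s)) \<longlongrightarrow> - euler_mascheroni * \<theta>) (at_right 0)"
    by (intro tendsto_mult euler_mean prime_log_family log_series_asymp)
  then show ?thesis
  proof (rule Lim_transform_eventually)
    show "\<forall>\<^sub>F s in at_right 0. ?M s * (s * prime_log_series A s) = prime_series A s - (\<Sum>p\<in>{p\<in>A. s * ln (real p) \<le> 1}. 1 / real p)"
      using eventually_at_right_less[of "0::real"]
    proof eventually_elim
      case (elim s)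
      let ?B = "{p\<in>A. s * ln (real p) \<le> 1}"
      have fin: "finite ?B"
      proof (rule finite_subset)
        show "?B \<subseteq> {..nat \<lfloor>exp (1 / s)\<rfloor>}"
        proof
          fix p assume "p \<in> ?B"
          then have p: "real p \<ge> 2" "s * ln (real p) \<le> 1" using A_ge_2 by auto
          then have "ln (real p) \<le> 1 / s" using elim by (simp add: field_simps)
          then have "exp (ln (real p)) \<le> exp (1 / s)" by simp
          then have "real p \<le> exp (1 / s)" using p by simp
          then show "p \<in> {..nat \<lfloor>exp (1 / s)\<rfloor>}" by (simp add: le_nat_floor)
        qed
      qed simp
      have "(\<lambda>p. ((if p \<in> A then real p powr (- 1 - s) else 0) - (if p \<in> ?B then 1 / real p else 0)) / s)
        sums ((prime_series A s - (\<Sum>p\<in>?B. 1 / real p)) / s)"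
        unfolding prime_series_def using elim fin
        by (intro sums_divide sums_diff summable_sums summable_prime_series sums_If_finite_set)
      moreover have "((if p \<in> A then real p powr (- 1 - s) else 0) - (if p \<in> ?B then 1 / real p else 0)) / s
        = prime_log_weight A p * exp (- (s * ln (real p))) * euler_test (exp (- (s * ln (real p))))" for p
      proof (cases "p \<in> A")
        case True
        then have p: "real p \<ge> 2" "ln (real p) > 0" using A_ge_2 ln_A_pos by blast+
        have "exp (- (s * ln (real p))) * euler_test (exp (- (s * ln (real p))))
            = (exp (- (s * ln (real p))) - of_bool (s * ln (real p) \<le> 1)) / (s * ln (real p))"
          using p elim by (intro euler_test_exp) auto
        also have e: "exp (- (s * ln (real p))) = real p powr (- s)"
          using p by (simp add: powr_def)
        finally have *: "real p powr (- s) * euler_test (real p powr (- s))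
            = (real p powr (- s) - of_bool (s * ln (real p) \<le> 1)) / (s * ln (real p))" .
        show ?thesis unfolding mult.assoc e * using True p elim
          by (auto simp: prime_log_weight_def powr_diff powr_minus divide_simps)
      qed (simp add: prime_log_weight_def)
      ultimately have "laplace_sum (prime_log_weight A) (\<lambda>p. ln (real p)) euler_test s
          = (prime_series A s - (\<Sum>p\<in>?B. 1 / real p)) / s"
        unfolding laplace_sum_def by (simp add: sums_iff)
      then show ?case
        using elim prime_log_series_pos[OF elim] by (simp add: laplace_mean_def laplace_sum_prime_log)
    qed
  qed
qed

lemma recip_ln_at_right: "filterlim (\<lambda>N. 1 / ln (real N)) (at_right 0) sequentially"
  by real_asymp

lemma prime_series_cutoff_LIMSEQ:
  "(\<lambda>N. prime_series A (1 / ln (real N)) - (\<Sum>p\<in>A \<inter> {..N}. 1 / real p)) \<longlonglongrightarrow> - euler_mascheroni * \<theta>"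
  using filterlim_compose[OF prime_series_cutoff recip_ln_at_right]
proof (rule Lim_transform_eventually)
  show "\<forall>\<^sub>F N in sequentially. prime_series A (1 / ln (real N)) - (\<Sum>p\<in>{p\<in>A. 1 / ln (real N) * ln (real p) \<le> 1}. 1 / real p)
     = prime_series A (1 / ln (real N)) - (\<Sum>p\<in>A \<inter> {..N}. 1 / real p)"
    using eventually_ge_at_top[of 2]
  proof eventually_elim
    case (elim N)
    have "1 / ln (real N) * ln (real p) \<le> 1 \<longleftrightarrow> p \<le> N" if "p \<in> A" for p
      using elim A_ge_2[OF that] by (simp add: divide_simps)
    then have "{p\<in>A. 1 / ln (real N) * ln (real p) \<le> 1} = A \<inter> {..N}" by auto
    then show ?case by simp
  qed
qed

end

section \<open>Multiplicative weights on A-smooth integers\<close>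

locale density_weight = prime_density + mertens_weight f for f
begin

definition smooth_weight :: "nat \<Rightarrow> real" where
  "smooth_weight n = (if n \<in> smooth A then f n else 0)"

lemma smooth_weight_term:
  "smooth_weight n * exp (- (s * ln (real n))) = (if n \<in> smooth A then f n * real n powr (- s) else 0)"
proof (cases "n \<in> smooth A")
  case True
  then have "n > 0" by (simp add: smooth_def)
  then show ?thesis using True by (simp add: smooth_weight_def exp_ln_powr)
qed (simp add: smooth_weight_def)

lemma laplace_sum_smooth_weight:
  assumes "s > 0"
  shows "laplace_sum smooth_weight (\<lambda>n. ln (real n)) (\<lambda>_. 1) s = exp (prime_series A s + log_correction A s)"
  unfolding laplace_sum_def mult_1_right smooth_weight_term
  using dirichlet_series_sums[OF primes assms] by (rule sums_unique[symmetric])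

text \<open>Exponentiating \<open>prime_series_ratio\<close> gives the index \<theta>; the
  corrections at js and s share a limit and cancel.\<close>

lemma smooth_weight_family: "laplace_family smooth_weight (\<lambda>n. ln (real n)) \<theta>"
proof
  show "0 \<le> smooth_weight n" for n by (simp add: smooth_weight_def nonneg)
  show "0 \<le> ln (real n)" for n by (cases "n = 0") auto
  show "summable (\<lambda>n. smooth_weight n * exp (- (s * ln (real n))))" if "s > 0" for s
    unfolding smooth_weight_term using dirichlet_series_sums[OF primes that] by (rule sums_summable)
  show "laplace_sum smooth_weight (\<lambda>n. ln (real n)) (\<lambda>_. 1) s > 0" if "s > 0" for s
    using that by (simp add: laplace_sum_smooth_weight)
  fix j :: nat assume j: "j \<ge> 1"
  have "((\<lambda>s. exp ((prime_series A (real j * s) - prime_series A s) + (log_correction A (real j * s) - log_correction A s)))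
     \<longlongrightarrow> exp (- \<theta> * ln (real j) + (euler_correction A - euler_correction A))) (at_right 0)"
    by (intro tendsto_exp tendsto_add tendsto_diff prime_series_ratio j log_correction_tendsto primes
          filterlim_compose[OF log_correction_tendsto[OF primes] filterlim_cmult_at_right_0])
      (use j in simp)
  then show "((\<lambda>s. laplace_sum smooth_weight (\<lambda>n. ln (real n)) (\<lambda>_. 1) (real j * s) /
      laplace_sum smooth_weight (\<lambda>n. ln (real n)) (\<lambda>_. 1) s) \<longlongrightarrow> real j powr - \<theta>) (at_right 0)"
  proof (rule Lim_transform_eventually[OF tendsto_eq_rhs])
    show "exp (- \<theta> * ln (real j) + (euler_correction A - euler_correction A)) = real j powr - \<theta>"
      using j by (simp add: powr_def)
    show "\<forall>\<^sub>F s in at_right 0. exp ((prime_series A (real j * s) - prime_series A s) + (log_correction A (real j * s) - log_correction A s))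
      = laplace_sum smooth_weight (\<lambda>n. ln (real n)) (\<lambda>_. 1) (real j * s) / laplace_sum smooth_weight (\<lambda>n. ln (real n)) (\<lambda>_. 1) s"
      using eventually_at_right_less[of "0::real"]
      by eventually_elim (use j in \<open>simp add: laplace_sum_smooth_weight exp_diff[symmetric] algebra_simps\<close>)
  qed
qed

text \<open>At s = 1 / ln N the step test keeps exactly n <= N and strips the factor n^(-s).\<close>

lemma partial_sums_asymp:
  "(\<lambda>N. (\<Sum>n\<in>smooth A \<inter> {..N}. f n) / exp (prime_series A (1 / ln (real N)) + log_correction A (1 / ln (real N))))
     \<longlonglongrightarrow> 1 / Gamma (\<theta> + 1)"
  using filterlim_compose[OF laplace_tauberian[OF smooth_weight_family theta_pos] recip_ln_at_right]
proof (rule Lim_transform_eventually)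
  show "\<forall>\<^sub>F N in sequentially. laplace_mean smooth_weight (\<lambda>n. ln (real n)) (step_test 1) (1 / ln (real N)) =
      (\<Sum>n\<in>smooth A \<inter> {..N}. f n) / exp (prime_series A (1 / ln (real N)) + log_correction A (1 / ln (real N)))"
    using eventually_ge_at_top[of 2]
  proof eventually_elim
    case (elim N)
    define s where "s = 1 / ln (real N)"
    have s: "s > 0" using elim by (simp add: s_def)
    have "smooth_weight n * exp (- (s * ln (real n))) * step_test 1 (exp (- (s * ln (real n))))
        = (if n \<in> smooth A \<inter> {..N} then f n else 0)" for n
    proof (cases "n \<in> smooth A")
      case True
      then have n: "n > 0" by (simp add: smooth_def)
      have "s * ln (real n) \<le> 1 \<longleftrightarrow> n \<le> N"
        using elim n by (simp add: s_def divide_simps)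
      then show ?thesis using True by (simp add: smooth_weight_def step_test_def)
    qed (simp add: smooth_weight_def)
    then have "laplace_sum smooth_weight (\<lambda>n. ln (real n)) (step_test 1) s = (\<Sum>n. if n \<in> smooth A \<inter> {..N} then f n else 0)"
      unfolding laplace_sum_def by simp
    also have "\<dots> = (\<Sum>n\<in>smooth A \<inter> {..N}. f n)"
      by (subst suminf_finite[of "smooth A \<inter> {..N}"]) auto
    finally show ?case unfolding s_def[symmetric] laplace_mean_def laplace_sum_smooth_weight[OF s] by simp
  qed
qed

text \<open>Numerator and partial sum are both divided by F(1 / ln N). In the logarithm of the first
  quotient the sum of 1/p over p <= N drops out, as does \<open>euler_correction A\<close>, leaving
  \<gamma>\<theta>.\<close>

theorem smooth_ratio_asymp:
  "(\<lambda>N. infsum (\<lambda>n. 1 / real n) (smooth (A \<inter> {..N})) / (\<Sum>n\<in>smooth A \<inter> {..N}. f n))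
     \<longlonglongrightarrow> exp (euler_mascheroni * \<theta>) * Gamma (\<theta> + 1)"
proof -
  let ?P = "\<lambda>N. infsum (\<lambda>n. 1 / real n) (smooth (A \<inter> {..N}))"
  let ?s = "\<lambda>N. 1 / ln (real N)"
  let ?F = "\<lambda>N. exp (prime_series A (?s N) + log_correction A (?s N))"
  have "(\<lambda>N. exp ((ln (?P N) - (\<Sum>p\<in>A \<inter> {..N}. 1 / real p))
      - (prime_series A (?s N) - (\<Sum>p\<in>A \<inter> {..N}. 1 / real p)) - log_correction A (?s N)))
    \<longlonglongrightarrow> exp (euler_correction A - (- euler_mascheroni * \<theta>) - euler_correction A)"
    by (intro tendsto_exp tendsto_diff prime_product_asymp primes prime_series_cutoff_LIMSEQ
          filterlim_compose[OF log_correction_tendsto[OF primes] recip_ln_at_right])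
  moreover have "exp ((ln (?P N) - (\<Sum>p\<in>A \<inter> {..N}. 1 / real p))
      - (prime_series A (?s N) - (\<Sum>p\<in>A \<inter> {..N}. 1 / real p)) - log_correction A (?s N)) = ?P N / ?F N" for N
  proof -
    have "?P N = (\<Prod>p\<in>A \<inter> {..N}. 1 / (1 - 1 / real p))"
      using primes by (intro infsum_smooth_recip) auto
    also have "\<dots> > 0"
    proof (rule prod_pos)
      fix p assume "p \<in> A \<inter> {..N}"
      then show "0 < 1 / (1 - 1 / real p)" using A_ge_2[of p] by simp
    qed
    finally have "?P N = exp (ln (?P N))" by simp
    then have "?P N / ?F N = exp (ln (?P N) - (prime_series A (?s N) + log_correction A (?s N)))"
      by (simp only: exp_diff)
    then show ?thesis by (simp add: algebra_simps)
  qed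
  ultimately have PF: "(\<lambda>N. ?P N / ?F N) \<longlonglongrightarrow> exp (euler_mascheroni * \<theta>)" by simp
  have "Gamma (\<theta> + 1) > 0" using theta_pos by (intro Gamma_real_pos) simp
  then have "(\<lambda>N. (?P N / ?F N) / ((\<Sum>n\<in>smooth A \<inter> {..N}. f n) / ?F N))
      \<longlonglongrightarrow> exp (euler_mascheroni * \<theta>) / (1 / Gamma (\<theta> + 1))"
    by (intro tendsto_divide PF partial_sums_asymp) simp
  then show ?thesis by simp
qed

end

section \<open>The weight on k-free integers\<close>

lemma kfree_pos: "kfree m a \<Longrightarrow> a > 0"
  unfolding kfree_def by (metis dvd_0_right gr0I two_is_prime_nat)

text \<open>Shows that the convention for m = 1 agrees with the general decomposition, so k = 2
  needs no separate treatment afterwards.\<close>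

lemma kfree_1_iff: "kfree 1 a \<longleftrightarrow> a = 1"
  unfolding kfree_def by (metis nat_dvd_1_iff_1 not_prime_1 power_one_right prime_factor_nat)

lemma kfree_mult_coprime:
  assumes "coprime a b" "m > 0"
  shows "kfree m (a * b) \<longleftrightarrow> kfree m a \<and> kfree m b"
proof
  assume *: "kfree m a \<and> kfree m b"
  show "kfree m (a * b)" unfolding kfree_def
  proof (intro allI impI notI)
    fix p :: nat assume p: "prime p" "p ^ m dvd a * b"
    have "coprime p a \<or> coprime p b"
      using assms(1) p(1) by (metis coprime_common_divisor not_prime_unit prime_imp_coprime)
    then have "p ^ m dvd b \<or> p ^ m dvd a"
      using p(2) by (metis coprime_dvd_mult_left_iff coprime_dvd_mult_right_iff coprime_power_left_iff)
    then show False using * p(1) by (auto simp: kfree_def)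
  qed
qed (auto simp: kfree_def)

lemma kfree_prime_power:
  assumes "prime p"
  shows "kfree m (p ^ j) \<longleftrightarrow> j < m"
proof
  assume "kfree m (p ^ j)"
  then have "\<not> p ^ m dvd p ^ j" using assms by (auto simp: kfree_def)
  then show "j < m" using le_imp_power_dvd not_le by blast
next
  assume j: "j < m"
  show "kfree m (p ^ j)" unfolding kfree_def
  proof (intro allI impI notI)
    fix q :: nat assume q: "prime q" "q ^ m dvd p ^ j"
    have "q dvd q ^ m" using j by (intro dvd_power) auto
    then have "q dvd p ^ j" using q(2) dvd_trans by blast
    then have "q = p" using q(1) assms prime_dvd_power primes_dvd_imp_eq by blast
    then show False using q(2) j prime_gt_1_nat[OF assms] power_dvd_imp_le by (metis not_le)
  qed
qed

lemma free_part_power_part_eq: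
  assumes "m \<ge> 1" "kfree m a" "b > 0" "is_nth_power m b"
  shows "free_part m (a * b) = a" "power_part m (a * b) = b"
proof -
  have pos: "a * b > 0" using kfree_pos[OF assms(2)] assms(3) by simp
  have "free_part m (a * b) = a \<and> power_part m (a * b) = b"
  proof (cases "m = 1")
    case True
    then have "a = 1" using assms(2) by (simp only: kfree_1_iff)
    then show ?thesis using True by (simp add: free_part_def power_part_def)
  next
    case False
    have "(THE x. kfree m x \<and> (\<exists>y. y > 0 \<and> is_nth_power m y \<and> a * b = x * y)) = a"
    proof (rule the_equality)
      fix x assume "kfree m x \<and> (\<exists>y. y > 0 \<and> is_nth_power m y \<and> a * b = x * y)"
      then obtain y where "kfree m x" "y > 0" "is_nth_power m y" "a * b = x * y" by blast
      then show "x = a" using free_power_decomp_unique(1)[OF assms(2-4) refl _ _ _ _ pos] by metis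
    qed (use assms in blast)
    moreover have "(THE y. y > 0 \<and> is_nth_power m y \<and> (\<exists>x. kfree m x \<and> a * b = x * y)) = b"
    proof (rule the_equality)
      fix y assume "y > 0 \<and> is_nth_power m y \<and> (\<exists>x. kfree m x \<and> a * b = x * y)"
      then obtain x where "kfree m x" "y > 0" "is_nth_power m y" "a * b = x * y" by blast
      then show "y = b" using free_power_decomp_unique(2)[OF assms(2-4) refl _ _ _ _ pos] by metis
    qed (use assms in blast)
    ultimately show ?thesis using False by (simp add: free_part_def power_part_def)
  qed
  then show "free_part m (a * b) = a" "power_part m (a * b) = b" by auto
qed

definition kfree_weight :: "nat \<Rightarrow> nat \<Rightarrow> real" where
  "kfree_weight k n = (if kfree k n then
     1 / (real (free_part (k - 1) n) * real (totient (power_part (k - 1) n))) else 0)"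

lemma kfree_weight_decomp:
  assumes "m \<ge> 1" "kfree m a" "b > 0" "is_nth_power m b" "kfree (Suc m) (a * b)"
  shows "kfree_weight (Suc m) (a * b) = 1 / (real a * real (totient b))"
  using assms free_part_power_part_eq[OF assms(1-4)] by (simp add: kfree_weight_def)

text \<open>For coprime arguments the free parts and the power parts multiply separately: a product
  of coprime m-free numbers is m-free, and a product of m-th powers is an m-th power.\<close>

lemma kfree_weight_mult:
  assumes "k \<ge> 2" "coprime x y"
  shows "kfree_weight k (x * y) = kfree_weight k x * kfree_weight k y"
proof (cases "kfree k x \<and> kfree k y")
  case True
  obtain m where k: "k = Suc m" "m \<ge> 1" using assms(1) by (cases k) auto
  have xy: "kfree k (x * y)" using True assms by (simp add: kfree_mult_coprime)
  obtain a b where x: "kfree m a" "b > 0" "is_nth_power m b" "x = a * b"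
    using free_power_decomp_exists[OF k(2), of x] True kfree_pos by blast
  obtain c d where y: "kfree m c" "d > 0" "is_nth_power m d" "y = c * d"
    using free_power_decomp_exists[OF k(2), of y] True kfree_pos by blast
  have cop: "coprime a c" "coprime b d" using assms(2) x(4) y(4) by auto
  have eq: "x * y = (a * c) * (b * d)" by (simp add: x y mult_ac)
  have "kfree m (a * c)" using x y cop k by (simp add: kfree_mult_coprime)
  then have "kfree_weight k (x * y) = 1 / (real (a * c) * real (totient (b * d)))"
    unfolding eq k(1) using x y k(2) xy[unfolded eq k(1)]
    by (intro kfree_weight_decomp is_nth_power_mult) auto
  also have "\<dots> = (1 / (real a * real (totient b))) * (1 / (real c * real (totient d)))"
    using cop by (simp add: totient_mult_coprime)
  also have "\<dots> = kfree_weight k x * kfree_weight k y"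
    using True x y k kfree_weight_decomp[of m] by simp
  finally show ?thesis .
next
  case False
  then have "\<not> kfree k (x * y)" using assms by (simp add: kfree_mult_coprime)
  then show ?thesis using False by (auto simp: kfree_weight_def)
qed

text \<open>p^j is its own free part for j < m, and p^m is its own power part, where the totient
  contributes 1 - 1/p.\<close>

lemma kfree_weight_prime_power:
  assumes "m \<ge> 1" "prime p"
  shows "kfree_weight (Suc m) (p ^ j) =
    (if j < m then (1 / real p) ^ j else if j = m then (1 / real p) ^ m / (1 - 1 / real p) else 0)"
proof -
  have p: "real p \<ge> 2" using prime_ge_2_nat[OF assms(2)] by simp
  consider "j < m" | "j = m" | "j > m" by linarith
  then show ?thesis
  proof cases
    case 1
    then have "kfree_weight (Suc m) (p ^ j * 1) = 1 / (real (p ^ j) * real (totient 1))"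
      using assms by (intro kfree_weight_decomp) (auto simp: kfree_prime_power)
    then show ?thesis using 1 by (simp add: power_divide)
  next
    case 2
    have "kfree_weight (Suc m) (1 * p ^ m) = 1 / (real 1 * real (totient (p ^ m)))"
      using assms kfree_prime_power[of p m 0]
      by (intro kfree_weight_decomp) (auto simp: kfree_prime_power prime_gt_0_nat)
    moreover have "real (totient (p ^ m)) = real p ^ m * (1 - 1 / real p)"
    proof -
      obtain l where l: "m = Suc l" using assms by (cases m) auto
      have "totient (p ^ m) = p ^ l * (p - 1)"
        using totient_prime_power_Suc[OF assms(2), of l] by (simp add: l)
      then show ?thesis using p by (simp add: l of_nat_diff field_simps)
    qed
    ultimately show ?thesis using 2 by (simp add: power_divide)
  next
    case 3
    then have "\<not> kfree (Suc m) (p ^ j)" using assms by (simp add: kfree_prime_power)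
    then show ?thesis using 3 by (simp add: kfree_weight_def)
  qed
qed

text \<open>The last nonzero term p^(-m) / (1 - 1/p) equals the whole geometric tail from j = m on.
  The totient thus compensates for the higher powers that k-freeness removes, which is why the limit
  does not depend on k.\<close>

lemma mertens_weight_kfree_weight:
  assumes "k \<ge> 2"
  shows "mertens_weight (kfree_weight k)"
proof
  obtain m where k: "k = Suc m" "m \<ge> 1" using assms by (cases k) auto
  show "0 \<le> kfree_weight k n" for n by (simp add: kfree_weight_def)
  show "kfree_weight k 1 = 1"
    using kfree_weight_prime_power[OF k(2) two_is_prime_nat, of 0] k by simp
  show "coprime x y \<Longrightarrow> kfree_weight k (x * y) = kfree_weight k x * kfree_weight k y" for x y
    using assms by (rule kfree_weight_mult)
  fix p :: nat assume p: "prime p"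
  have p2: "real p \<ge> 2" using prime_ge_2_nat[OF p] by simp
  show "1 / real p \<le> kfree_weight k p"
    using kfree_weight_prime_power[OF k(2) p, of 1] k p2 by (auto simp: field_simps)
  have "(\<lambda>j. kfree_weight k (p ^ j)) sums (\<Sum>j\<in>{..m}. kfree_weight k (p ^ j))"
    using kfree_weight_prime_power[OF k(2) p] k by (intro sums_finite) auto
  also have "(\<Sum>j\<in>{..m}. kfree_weight k (p ^ j)) = (\<Sum>j<m. (1 / real p) ^ j) + (1 / real p) ^ m / (1 - 1 / real p)"
    using kfree_weight_prime_power[OF k(2) p] k by (simp flip: lessThan_Suc_atMost)
  also have "\<dots> = 1 / (1 - 1 / real p)"
    using p2 by (subst sum_gp_strict) (simp_all flip: add_divide_distrib)
  finally show "(\<lambda>j. kfree_weight k (p ^ j)) sums (1 / (1 - 1 / real p))" .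
qed

theorem theorem3:
  fixes A :: "nat set" and \<theta> :: real and k :: nat
  assumes "A \<subseteq> {p. prime p}"
    and "0 < \<theta>" and "\<theta> \<le> 1"
    and "has_prime_density A \<theta>"
    and "k \<ge> 2"
  shows "(\<lambda>N::nat.
      (\<Sum>\<^sub>\<infinity>n\<in>{n::nat. n > 0 \<and> (\<forall>p. prime p \<and> p dvd n \<longrightarrow> p \<le> N \<and> p \<in> A)}. 1 / real n) /
      (\<Sum>n\<in>{n::nat. 1 \<le> n \<and> n \<le> N \<and> kfree k n \<and> (\<forall>p. prime p \<and> p dvd n \<longrightarrow> p \<in> A)}.
         1 / (real (free_part (k - 1) n) * real (totient (power_part (k - 1) n)))))
    \<longlonglongrightarrow> exp (euler_mascheroni * \<theta>) * Gamma (\<theta> + 1)"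
proof -
  interpret mertens_weight "kfree_weight k"
    using assms(5) by (rule mertens_weight_kfree_weight)
  interpret density_weight A \<theta> "kfree_weight k"
    using assms by unfold_locales
  have num: "{n::nat. n > 0 \<and> (\<forall>p. prime p \<and> p dvd n \<longrightarrow> p \<le> N \<and> p \<in> A)} = smooth (A \<inter> {..N})" for N
    by (auto simp: smooth_def)
  have den: "(\<Sum>n\<in>{n::nat. 1 \<le> n \<and> n \<le> N \<and> kfree k n \<and> (\<forall>p. prime p \<and> p dvd n \<longrightarrow> p \<in> A)}.
         1 / (real (free_part (k - 1) n) * real (totient (power_part (k - 1) n))))
      = (\<Sum>n\<in>smooth A \<inter> {..N}. kfree_weight k n)" for N
    by (rule sum.mono_neutral_cong_left) (auto simp: smooth_def kfree_weight_def)
  show ?thesis unfolding num den by (rule smooth_ratio_asymp)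
qed

end
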